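(* Let $\mathcal{P}$ be the class of all planar graphs. Then $\lambda_{\mathcal{P}}(k) = \Theta(k^3)$ as a function of $k$.
   Context: All graphs are finite and have no loops or multiple edges. For $k\in\mathbb{N}$, $[k]=\{1,\ldots,k\}$. A $k$-edge-colored graph is a pair $(G,c)$ where $G$ is a graph (the underlying graph) and $c:E(G)\to[k]$ is an arbitrary mapping (not required to be a proper edge coloring). A homomorphism of a $k$-edge-colored graph $(G_1,c_1)$ to a $k$-edge-colored graph $(G_2,c_2)$ is a mapping $h:V(G_1)\to V(G_2)$ such that for every two vertices $u,v$ adjacent in $G_1$, $h(u)$ and $h(v)$ are adjacent in $G_2$ and $c_1(\{u,v\})=c_2(\{h(u),h(v)\})$. A $k$-edge-colored graph $\mathbb{H}$ (finite, with underlying graph not necessarily in $\mathcal{F}$) is $k$-universal for a class $\mathcal{F}$ of graphs if every $k$-edge-colored graph whose underlying graph is in $\mathcal{F}$ admits a homomorphism to $\mathbb{H}$. $\lambda_{\mathcal{F}}(k)$ is the minimum number of vertices in a $k$-universal graph for $\mathcal{F}$, and $\lambda_{\mathcal{F}}(k)=\infty$ if no such graph exists. Notation: $f(k)=O(g(k))$ means that there exist constants $n_0,c$ with $|f(k)|\le c|g(k)|$ for all $k\ge n_0$; $f(k)=\Theta(g(k))$ means both $f(k)=O(g(k))$ and $g(k)=O(f(k))$. *)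

theory Defs
  imports "HOL-Analysis.Analysis" "HOL-Library.Extended_Nat" "HOL-Library.Landau_Symbols"
begin

type_synonym 'a graph = "'a set \<times> 'a set set"

abbreviation verts :: "'a graph \<Rightarrow> 'a set" where "verts \<equiv> fst"
abbreviation edges :: "'a graph \<Rightarrow> 'a set set" where "edges \<equiv> snd"

definition fin_graph :: "'a graph \<Rightarrow> bool" where
  "fin_graph G \<longleftrightarrow> finite (verts G) \<and> (\<forall>e\<in>edges G. e \<subseteq> verts G \<and> card e = 2)"

text \<open>Only the values of the colouring on edges are ever inspected.\<close>

type_synonym 'a ecgraph = "'a graph \<times> ('a set \<Rightarrow> nat)"

definition ec_graph :: "nat \<Rightarrow> 'a ecgraph \<Rightarrow> bool" where
  "ec_graph k = (\<lambda>(G, c). fin_graph G \<and> c ` edges G \<subseteq> {1..k})"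

definition ec_hom :: "('a \<Rightarrow> 'b) \<Rightarrow> 'a ecgraph \<Rightarrow> 'b ecgraph \<Rightarrow> bool" where
  "ec_hom h = (\<lambda>(G1, c1) (G2, c2).
     h ` verts G1 \<subseteq> verts G2 \<and>
     (\<forall>u v. {u, v} \<in> edges G1 \<longrightarrow>
        {h u, h v} \<in> edges G2 \<and> c1 {u, v} = c2 {h u, h v}))"

definition universal :: "'a graph set \<Rightarrow> nat \<Rightarrow> 'b ecgraph \<Rightarrow> bool" where
  "universal F k H \<longleftrightarrow>
     ec_graph k H \<and> (\<forall>G\<in>F. \<forall>c. ec_graph k (G, c) \<longrightarrow> (\<exists>h. ec_hom h (G, c) H))"

text \<open>
  Every finite graph has an isomorphic copy on natural numbers, so it suffices to let both the
  members of the class and the universal graphs have vertices in \<^typ>\<open>nat\<close>.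
  The infimum over a nonempty set of \<^typ>\<open>enat\<close> values is attained, and
  the infimum over the empty set is \<^term>\<open>\<infinity> :: enat\<close>.
\<close>

definition lambda_univ :: "nat graph set \<Rightarrow> nat \<Rightarrow> enat" where
  "lambda_univ F k =
     (INF H \<in> {H :: nat ecgraph. universal F k H}. enat (card (verts (fst H))))"

text \<open>
  Topological drawings in the plane, identified with \<^typ>\<open>complex\<close>: vertices are distinct points,
  edges are arcs joining the points of their ends, and the interior of an arc contains
  no vertex and meets no other arc.
\<close>

definition plane_drawing ::
  "'a graph \<Rightarrow> ('a \<Rightarrow> complex) \<Rightarrow> ('a set \<Rightarrow> real \<Rightarrow> complex) \<Rightarrow> bool" where
  "plane_drawing G p \<gamma> \<longleftrightarrow>
     inj_on p (verts G) \<and>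
     (\<forall>e\<in>edges G.
        arc (\<gamma> e) \<and> {pathstart (\<gamma> e), pathfinish (\<gamma> e)} = p ` e \<and>
        \<gamma> e ` {0<..<1} \<inter> p ` verts G = {} \<and>
        (\<forall>f\<in>edges G. f \<noteq> e \<longrightarrow> \<gamma> e ` {0<..<1} \<inter> path_image (\<gamma> f) = {}))"

definition planar :: "'a graph \<Rightarrow> bool" where
  "planar G \<longleftrightarrow> fin_graph G \<and> (\<exists>p \<gamma>. plane_drawing G p \<gamma>)"

end

theory Submission
  imports Defs
begin

text \<open>
  Two arguments meet at the exponent \<open>3\<close>, the supremum of the ratio of edges to vertices over planar
  graphs.

  Lower bound. A homomorphism from a coloured graph determines the colouring, so a universal graph on
  \<open>N\<close> vertices satisfies \<open>k ^ |E| \<le> N ^ |V|\<close> for each planar graph \<open>(V, E)\<close>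
  (\<open>universal_counting\<close>). The double fan over a path has a straight-line drawing and \<open>3 |V| - 7\<close>
  edges (\<open>planar_fan\<close>, \<open>card_fan_edges\<close>). Since \<open>N\<close> and \<open>k\<close> stay fixed while the path grows,
  \<open>N \<ge> k ^ 3\<close> follows.

  Upper bound. Every subgraph of a planar graph has at most three edges per vertex
  (\<open>plane_graph_edge_bound\<close>), so a Hall-type argument orients the edges with outdegree at most three
  (\<open>orientation_outdegree_3\<close>). The idea is that a vertex stores the colours of its at most three
  outgoing edges, which costs a factor \<open>k ^ 3\<close>. To address these edges, the vertices receive
  auxiliary colours from a constant palette, chosen so that any two vertices joined by an edge, by a
  directed path with two edges, or by two edges leaving a common vertex, differ. Then the two labels at
  the ends of an edge determine its colour, and the labels form the universal graph
  (\<open>hom_to_target\<close>). A constant palette suffices because the graph of these conflicts is sparse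
  (\<open>conflict_sparse\<close>): the only kind of conflict that is not bounded by the outdegree alone, two
  vertices of a set with a common in-neighbour outside of it, becomes an edge of a planar graph after
  the in-neighbour is suppressed, so the edge bound applies once more.

  The edge bound is proved for topological drawings without counting faces. Let \<open>C\<close> be a cycle of
  length \<open>l\<close> with \<open>i\<close> vertices in its interior. Then at most \<open>3 i + l - 3\<close> edges run inside
  \<open>C\<close> (\<open>inner_edges_bound\<close>). If two vertices of \<open>C\<close> are joined by a path through the interior, that
  path cuts the interior into two Jordan domains (\<open>ear_split\<close>), and the bounds for the two smaller cycles
  add up exactly. Otherwise each component of the inner vertices hangs on at most one vertex of \<open>C\<close>,
  and the edge bound for smaller graphs applies to it (\<open>earless_attachment\<close>). The inversion
  \<open>1 / (z - a)\<close> with \<open>a\<close> inside \<open>C\<close> turns the outside of \<open>C\<close> into an inside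
  (\<open>inversion_swaps_sides\<close>), and the sum of the two estimates is the bound for the whole graph.
\<close>

section \<open>Walks and cycles as sets of edges\<close>

fun walk_edges :: "'a list \<Rightarrow> 'a set set" where
  "walk_edges (x # y # zs) = insert {x, y} (walk_edges (y # zs))"
| "walk_edges _ = {}"

definition cycle_edges :: "'a list \<Rightarrow> 'a set set" where
  "cycle_edges xs = walk_edges (xs @ [hd xs])"

lemma walk_edges_append: "walk_edges (xs @ y # zs) = walk_edges (xs @ [y]) \<union> walk_edges (y # zs)"
  by (induction xs rule: walk_edges.induct) (auto simp: insert_commute)

lemma walk_edges_rev: "walk_edges (rev xs) = walk_edges xs"
proof (induction xs rule: walk_edges.induct)
  case (1 x y zs)
  have "walk_edges (rev zs @ y # [x]) = walk_edges (rev zs @ [y]) \<union> {{y, x}}"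
    by (subst walk_edges_append) simp
  with 1 show ?case by (simp add: insert_commute)
qed auto

lemma Union_walk_edges: "2 \<le> length xs \<Longrightarrow> \<Union>(walk_edges xs) = set xs"
proof (induction xs rule: walk_edges.induct)
  case (1 x y zs)
  then show ?case by (cases zs) auto
qed auto

lemma Union_walk_edges_subset: "\<Union>(walk_edges xs) \<subseteq> set xs"
  by (induction xs rule: walk_edges.induct) auto

lemma finite_walk_edges [simp]: "finite (walk_edges xs)"
  by (induction xs rule: walk_edges.induct) auto

lemma card_walk_edges: "distinct xs \<Longrightarrow> card (walk_edges xs) = length xs - 1"
proof (induction xs rule: walk_edges.induct)
  case (1 x y zs)
  then have "{x, y} \<notin> walk_edges (y # zs)"
    using Union_walk_edges_subset[of "y # zs"] by auto
  with 1 show ?case by simp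
qed auto

lemma cycle_edges_split: "cycle_edges (a # ys @ b # zs) = walk_edges (a # ys @ [b]) \<union> walk_edges (b # zs @ [a])"
  unfolding cycle_edges_def using walk_edges_append[of "a # ys" b "zs @ [a]"] by simp

lemma cycle_edges_rotate: "cycle_edges (us @ a # ws) = cycle_edges (a # ws @ us)"
proof (cases us)
  case (Cons u us')
  then show ?thesis
    using cycle_edges_split[of u us' a ws] cycle_edges_split[of a ws u us'] by auto
qed simp

lemma cycle_edges_two_vertices:
  assumes "distinct C" "a \<in> set C" "b \<in> set C" "a \<noteq> b"
  obtains ys zs where "cycle_edges C = cycle_edges (a # ys @ b # zs)" "set C = set (a # ys @ b # zs)"
    "length C = length (a # ys @ b # zs)" "distinct (a # ys @ b # zs)"
proof -
  obtain us ws where C: "C = us @ a # ws" using assms(2) by (meson split_list)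
  then have "b \<in> set (ws @ us)" using assms by auto
  then obtain ys zs where yz: "ws @ us = ys @ b # zs" by (meson split_list)
  have "set C = set (a # (ws @ us))" "length C = length (a # (ws @ us))" "distinct (a # (ws @ us))"
    using C assms(1) by auto
  moreover have "cycle_edges C = cycle_edges (a # (ws @ us))" using C cycle_edges_rotate by simp
  ultimately show ?thesis using that yz by metis
qed

text \<open>
  The form in which a cycle is split by an ear: both arcs run from \<open>a\<close> to \<open>b\<close>, as
  \<open>split_inside_simple_closed_curve\<close> expects them.
\<close>

lemma cycle_edges_rev_part: "cycle_edges (a # ys @ b # rev ws) = walk_edges (a # ys @ [b]) \<union> walk_edges (a # ws @ [b])"
  using walk_edges_rev[of "a # ws @ [b]"] by (simp add: cycle_edges_split)

lemma card_cycle_edges: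
  assumes "distinct C" "3 \<le> length C"
  shows "card (cycle_edges C) = length C"
proof -
  obtain a ys b where C: "C = a # ys @ [b]" "ys \<noteq> []"
    using assms(2) by (cases C; cases "tl C" rule: rev_cases) force+
  have "cycle_edges C = insert {b, a} (walk_edges C)"
    using cycle_edges_split[of a ys b "[]"] C by simp
  moreover have "{b, a} \<notin> walk_edges C"
  proof -
    obtain y ys' where y: "ys = y # ys'" using C by (cases ys) auto
    have "walk_edges C = insert {a, y} (walk_edges (ys @ [b]))" using C y by simp
    moreover have "{b, a} \<noteq> {a, y}" using assms(1) C y by (auto simp: doubleton_eq_iff)
    moreover have "a \<notin> \<Union>(walk_edges (ys @ [b]))"
      using Union_walk_edges_subset[of "ys @ [b]"] assms(1) C by auto
    ultimately show ?thesis by auto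
  qed
  ultimately show ?thesis using card_walk_edges[of C] assms by simp
qed

section \<open>Drawings as point sets, and the two sides of a cycle\<close>

locale plane_graph =
  fixes V :: "'a set" and E :: "'a set set" and p :: "'a \<Rightarrow> complex"
    and \<gamma> :: "'a set \<Rightarrow> real \<Rightarrow> complex"
  assumes fin: "fin_graph (V, E)" and drawing: "plane_drawing (V, E) p \<gamma>"
begin

definition drawn :: "'a set set \<Rightarrow> complex set" where
  "drawn F = (\<Union>e\<in>F. path_image (\<gamma> e))"

abbreviation open_arc :: "'a set \<Rightarrow> complex set" where
  "open_arc e \<equiv> \<gamma> e ` {0<..<1}"

lemma finV: "finite V" using fin by (simp add: fin_graph_def)
lemma edge_sub: "e \<in> E \<Longrightarrow> e \<subseteq> V" using fin by (simp add: fin_graph_def)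
lemma edge_card: "e \<in> E \<Longrightarrow> card e = 2" using fin by (simp add: fin_graph_def)
lemma finE: "finite E"
  by (rule finite_subset[of _ "Pow V"]) (use edge_sub finV in auto)

lemma edge_arc: "e \<in> E \<Longrightarrow> arc (\<gamma> e)"
  using drawing by (simp add: plane_drawing_def)

lemma p_inj: "inj_on p V" using drawing by (simp add: plane_drawing_def)

lemma ends: "e \<in> E \<Longrightarrow> {pathstart (\<gamma> e), pathfinish (\<gamma> e)} = p ` e"
  using drawing by (simp add: plane_drawing_def)

lemma open_arc_verts: "e \<in> E \<Longrightarrow> open_arc e \<inter> p ` V = {}"
  using drawing by (simp add: plane_drawing_def)

lemma open_arc_other: "e \<in> E \<Longrightarrow> f \<in> E \<Longrightarrow> f \<noteq> e \<Longrightarrow> open_arc e \<inter> path_image (\<gamma> f) = {}"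
  using drawing by (simp add: plane_drawing_def)

lemma path_image_edge: assumes "e \<in> E" shows "path_image (\<gamma> e) = open_arc e \<union> p ` e"
proof -
  have "{0..1::real} = {0<..<1} \<union> {0, 1}" by auto
  then have "path_image (\<gamma> e) = open_arc e \<union> {pathstart (\<gamma> e), pathfinish (\<gamma> e)}"
    by (simp add: path_image_def pathstart_def pathfinish_def image_Un)
  then show ?thesis using ends[OF assms] by simp
qed

text \<open>
  Drawings of edge-disjoint subgraphs meet only in common vertices. All intersection conditions of the
  Jordan-type theorems below reduce to this combinatorial fact.
\<close>

lemma drawn_Int:
  assumes "F1 \<subseteq> E" "F2 \<subseteq> E" "F1 \<inter> F2 = {}"
  shows "drawn F1 \<inter> drawn F2 = p ` (\<Union>F1 \<inter> \<Union>F2)"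
proof
  show "drawn F1 \<inter> drawn F2 \<subseteq> p ` (\<Union>F1 \<inter> \<Union>F2)"
  proof
    fix z assume "z \<in> drawn F1 \<inter> drawn F2"
    then obtain e f where ef: "e \<in> F1" "f \<in> F2" "z \<in> path_image (\<gamma> e)" "z \<in> path_image (\<gamma> f)"
      by (auto simp: drawn_def)
    then have E: "e \<in> E" "f \<in> E" "e \<noteq> f" using assms by auto
    then have "z \<in> p ` e" "z \<in> p ` f"
      using ef open_arc_other[OF E(1,2)] open_arc_other[OF E(2,1)] path_image_edge[OF E(1)] path_image_edge[OF E(2)]
      by (simp_all add: disjoint_iff) blast+
    then obtain x y where "x \<in> e" "y \<in> f" "z = p x" "z = p y" by auto
    moreover then have "x = y" using p_inj E edge_sub by (metis inj_onD subsetD)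
    ultimately show "z \<in> p ` (\<Union>F1 \<inter> \<Union>F2)" using ef by auto
  qed
next
  show "p ` (\<Union>F1 \<inter> \<Union>F2) \<subseteq> drawn F1 \<inter> drawn F2"
  proof
    fix z assume "z \<in> p ` (\<Union>F1 \<inter> \<Union>F2)"
    then obtain x e f where "x \<in> e" "e \<in> F1" "x \<in> f" "f \<in> F2" "z = p x" by auto
    moreover then have "e \<in> E" "f \<in> E" using assms by auto
    ultimately have "z \<in> path_image (\<gamma> e)" "z \<in> path_image (\<gamma> f)"
      by (auto simp: path_image_edge)
    then show "z \<in> drawn F1 \<inter> drawn F2"
      using \<open>e \<in> F1\<close> \<open>f \<in> F2\<close> by (auto simp: drawn_def)
  qed
qed

lemma edge_arc_oriented:
  assumes "{x, y} \<in> E"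
  obtains g where "arc g" "pathstart g = p x" "pathfinish g = p y"
    "path_image g = path_image (\<gamma> {x, y})"
proof -
  have "{pathstart (\<gamma> {x,y}), pathfinish (\<gamma> {x,y})} = {p x, p y}"
    using ends[OF assms] by simp
  then consider "pathstart (\<gamma> {x,y}) = p x" "pathfinish (\<gamma> {x,y}) = p y"
    | "pathstart (\<gamma> {x,y}) = p y" "pathfinish (\<gamma> {x,y}) = p x"
    by (auto simp: doubleton_eq_iff)
  then show ?thesis
  proof cases
    case 1 then show ?thesis using that edge_arc[OF assms] by blast
  next
    case 2 then show ?thesis
      using that[of "reversepath (\<gamma> {x,y})"] edge_arc[OF assms] by (simp add: arc_reversepath)
  qed
qed

lemma walk_arc:
  assumes "distinct xs" "2 \<le> length xs" "walk_edges xs \<subseteq> E"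
  shows "\<exists>g. arc g \<and> pathstart g = p (hd xs) \<and> pathfinish g = p (last xs) \<and> path_image g = drawn (walk_edges xs)"
  using assms
proof (induction xs rule: walk_edges.induct)
  case (1 x y zs)
  have xyE: "{x, y} \<in> E" using 1 by simp
  then obtain g where g: "arc g" "pathstart g = p x" "pathfinish g = p y"
    "path_image g = path_image (\<gamma> {x, y})" by (rule edge_arc_oriented)
  show ?case
  proof (cases zs)
    case Nil
    then show ?thesis using g by (auto simp: drawn_def)
  next
    case (Cons z zs')
    then obtain h where h: "arc h" "pathstart h = p y" "pathfinish h = p (last (y # zs))"
      "path_image h = drawn (walk_edges (y # zs))"
      using 1 by auto
    have "{x, y} \<notin> walk_edges (y # zs)"
      using Union_walk_edges_subset[of "y # zs"] 1(2) by auto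
    then have "drawn {{x, y}} \<inter> drawn (walk_edges (y # zs)) = p ` ({x, y} \<inter> \<Union>(walk_edges (y # zs)))"
      using drawn_Int[of "{{x, y}}" "walk_edges (y # zs)"] 1(4) by simp
    also have "\<dots> = {p y}"
      using Union_walk_edges[of "y # zs"] Cons 1(2) by auto
    finally have "path_image g \<inter> path_image h \<subseteq> {pathstart h}"
      using g h by (simp add: drawn_def)
    then have "arc (g +++ h)" using g h by (intro arc_join) auto
    moreover have "path_image (g +++ h) = drawn (walk_edges (x # y # zs))"
      using g h by (subst path_image_join) (auto simp: drawn_def)
    ultimately show ?thesis using g h by (intro exI[of _ "g +++ h"]) auto
  qed
qed auto

lemma drawn_Un: "drawn (F1 \<union> F2) = drawn F1 \<union> drawn F2" by (auto simp: drawn_def)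

end

definition is_cycle :: "'a set set \<Rightarrow> 'a list \<Rightarrow> bool" where
  "is_cycle E C \<longleftrightarrow> distinct C \<and> 3 \<le> length C \<and> cycle_edges C \<subseteq> E"

lemma Union_cycle_edges: "3 \<le> length C \<Longrightarrow> \<Union>(cycle_edges C) = set C"
  unfolding cycle_edges_def by (subst Union_walk_edges) (cases C; auto)+

lemma cycle_as_two_walks:
  assumes "is_cycle E C" "a \<in> set C" "b \<in> set C" "a \<noteq> b"
  obtains ys zs where "cycle_edges C = walk_edges (a # ys @ [b]) \<union> walk_edges (a # rev zs @ [b])"
    "set C = set (a # ys @ b # zs)" "length C = length ys + length zs + 2"
    "distinct (a # ys @ b # zs)" "ys \<noteq> [] \<or> zs \<noteq> []"
proof -
  obtain ys zs where yz: "cycle_edges C = cycle_edges (a # ys @ b # zs)" "set C = set (a # ys @ b # zs)"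
    "length C = length (a # ys @ b # zs)" "distinct (a # ys @ b # zs)"
    using assms cycle_edges_two_vertices[of C a b] unfolding is_cycle_def by metis
  moreover have "cycle_edges C = walk_edges (a # ys @ [b]) \<union> walk_edges (a # rev zs @ [b])"
    using yz(1) cycle_edges_rev_part[of a ys b "rev zs"] by simp
  ultimately show ?thesis using that assms(1) unfolding is_cycle_def by fastforce
qed

lemma walk_edges_disjoint:
  assumes "distinct (a # ys @ b # ws)" "ys \<noteq> [] \<or> ws \<noteq> []"
  shows "walk_edges (a # ys @ [b]) \<inter> walk_edges (a # ws @ [b]) = {}"
proof (rule ccontr)
  assume "\<not> ?thesis"
  then obtain e where e: "e \<in> walk_edges (a # ys @ [b])" "e \<in> walk_edges (a # ws @ [b])" by auto
  have sub: "e \<subseteq> {a, b}"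
    using e Union_walk_edges_subset[of "a # ys @ [b]"] Union_walk_edges_subset[of "a # ws @ [b]"] assms(1)
    by auto
  have key: False if "us \<noteq> []" "e \<in> walk_edges (a # us @ [b])" "distinct (a # us @ [b])" for us
  proof -
    obtain u us' where u: "us = u # us'" using \<open>us \<noteq> []\<close> by (cases us) auto
    have eq: "walk_edges (a # us @ [b]) = insert {a, u} (walk_edges (us @ [b]))" using u by simp
    have "e \<noteq> {a, u}" using sub that(3) u by auto
    then have e1: "e \<in> walk_edges (us @ [b])" using that(2) eq by auto
    then have "e \<subseteq> {b}"
      using sub Union_walk_edges_subset[of "us @ [b]"] that(3) by auto
    moreover have "card e = 2" using e1 that(3)
    proof -
      have "e \<in> walk_edges xs \<Longrightarrow> distinct xs \<Longrightarrow> card e = 2" for xs :: "'a list"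
        by (induction xs rule: walk_edges.induct) auto
      then show ?thesis using e1 that(3) by simp
    qed
    ultimately show False
      using card_mono[of "{b}" e] by simp
  qed
  show False using assms key[of ys] key[of ws] e by auto
qed

context plane_graph
begin

lemma vertex_on_drawn:
  assumes "F \<subseteq> E" "v \<in> V" "p v \<in> drawn F"
  shows "v \<in> \<Union>F"
proof -
  obtain e where e: "e \<in> F" "p v \<in> path_image (\<gamma> e)" using assms by (auto simp: drawn_def)
  then have "e \<in> E" using assms by auto
  then have "p v \<in> p ` e"
    using e(2) path_image_edge[OF \<open>e \<in> E\<close>] open_arc_verts[OF \<open>e \<in> E\<close>] assms(2) by auto
  then have "v \<in> e"
    using inj_on_image_mem_iff[OF p_inj assms(2) edge_sub[OF \<open>e \<in> E\<close>]] by simp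
  then show ?thesis using e by auto
qed

text \<open>
  A cycle is drawn as a simple closed curve: cut it at two vertices into two walks, each of which is an
  arc.
\<close>

lemma cycle_Jordan:
  assumes "is_cycle E C"
  defines "J \<equiv> drawn (cycle_edges C)"
  shows "inside J \<noteq> {}" "open (inside J)" "connected (inside J)" "open (outside J)"
    "connected (outside J)" "bounded (inside J)" "\<not> bounded (outside J)"
    "inside J \<inter> outside J = {}" "inside J \<union> outside J = - J" "frontier (inside J) = J" "closed J"
proof -
  obtain a b where ab: "a \<in> set C" "b \<in> set C" "a \<noteq> b"
    using assms(1) unfolding is_cycle_def
    by (cases C; cases "tl C") auto
  obtain ys zs where yz: "cycle_edges C = walk_edges (a # ys @ [b]) \<union> walk_edges (a # rev zs @ [b])"
    "set C = set (a # ys @ b # zs)" "length C = length ys + length zs + 2"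
    "distinct (a # ys @ b # zs)" "ys \<noteq> [] \<or> zs \<noteq> []"
    using cycle_as_two_walks[OF assms(1) ab] by metis
  have sE: "walk_edges (a # ys @ [b]) \<subseteq> E" "walk_edges (a # rev zs @ [b]) \<subseteq> E"
    using yz(1) assms(1) by (auto simp: is_cycle_def)
  obtain g where g: "arc g" "pathstart g = p a" "pathfinish g = p b"
    "path_image g = drawn (walk_edges (a # ys @ [b]))"
    using walk_arc[of "a # ys @ [b]"] yz sE by auto
  obtain h where h: "arc h" "pathstart h = p a" "pathfinish h = p b"
    "path_image h = drawn (walk_edges (a # rev zs @ [b]))"
    using walk_arc[of "a # rev zs @ [b]"] yz sE by auto
  have "path_image g \<inter> path_image h = p ` (set (a # ys @ [b]) \<inter> set (a # rev zs @ [b]))"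
    unfolding g h
    using drawn_Int[OF sE] walk_edges_disjoint[of a ys b "rev zs"] yz(4,5)
      Union_walk_edges[of "a # ys @ [b]"] Union_walk_edges[of "a # rev zs @ [b]"] by auto
  also have "\<dots> = {p a, p b}" using yz(4) by auto
  finally have int: "path_image g \<inter> path_image h = {p a, p b}" .
  define c where "c = g +++ reversepath h"
  have c: "simple_path c" "pathfinish c = pathstart c" "path_image c = J"
    unfolding c_def J_def yz(1) drawn_Un using g h int
    by (auto simp: simple_path_join_loop_eq arc_reversepath path_image_join)
  show "inside J \<noteq> {}" "open (inside J)" "connected (inside J)" "open (outside J)"
    "connected (outside J)" "bounded (inside J)" "\<not> bounded (outside J)"
    "inside J \<inter> outside J = {}" "inside J \<union> outside J = - J" "frontier (inside J) = J" 
    using Jordan_inside_outside[OF c(1,2)] unfolding c(3) by auto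
  show "closed J" using closed_simple_path_image[OF c(1)] c(3) by simp
qed

text \<open>
  An edge off the cycle lies on one side of it as a whole, so its midpoint can serve as the test.
\<close>

definition inner_edges :: "'a list \<Rightarrow> 'a set set" where
  "inner_edges C = {e \<in> E. \<gamma> e (1/2) \<in> inside (drawn (cycle_edges C))}"

definition inner_verts :: "'a list \<Rightarrow> 'a set" where
  "inner_verts C = {v \<in> V. p v \<in> inside (drawn (cycle_edges C))}"

lemma vertex_on_cycle:
  assumes "is_cycle E C" "v \<in> V"
  shows "p v \<in> drawn (cycle_edges C) \<longleftrightarrow> v \<in> set C"
proof
  assume "p v \<in> drawn (cycle_edges C)"
  then have "v \<in> \<Union>(cycle_edges C)"
    using vertex_on_drawn[of "cycle_edges C" v] assms by (simp add: is_cycle_def)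
  then show "v \<in> set C" using Union_cycle_edges assms by (auto simp: is_cycle_def)
next
  assume "v \<in> set C"
  then obtain e where "e \<in> cycle_edges C" "v \<in> e" using Union_cycle_edges[of C] assms by (auto simp: is_cycle_def)
  moreover then have "e \<in> E" using assms by (auto simp: is_cycle_def)
  ultimately show "p v \<in> drawn (cycle_edges C)" using path_image_edge[of e] by (auto simp: drawn_def)
qed

lemma open_arc_off_cycle:
  assumes "is_cycle E C" "e \<in> E" "e \<notin> cycle_edges C"
  shows "open_arc e \<inter> drawn (cycle_edges C) = {}"
  using assms open_arc_other[of e] unfolding is_cycle_def drawn_def by blast

lemma midpoint_in_open_arc: "\<gamma> e (1/2) \<in> open_arc e" by auto

lemma open_arc_connected: "e \<in> E \<Longrightarrow> connected (open_arc e)"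
  using edge_arc[of e]
  by (intro connected_continuous_image) (auto simp: arc_def path_def elim: continuous_on_subset)

lemma ends_in_closure_open_arc: assumes "e \<in> E" shows "p ` e \<subseteq> closure (open_arc e)"
proof -
  have c: "continuous_on (closure {0<..<1::real}) (\<gamma> e)"
    using edge_arc[OF assms] by (simp add: arc_def path_def)
  have "\<gamma> e ` closure {0<..<1} \<subseteq> closure (open_arc e)"
    by (rule image_closure_subset[OF c]) (auto simp: closure_subset)
  then have "path_image (\<gamma> e) \<subseteq> closure (open_arc e)" by (simp add: path_image_def)
  then show ?thesis using path_image_edge[OF assms] by auto
qed

lemma inner_edge_arc:
  assumes "is_cycle E C" "e \<in> inner_edges C"
  shows "open_arc e \<subseteq> inside (drawn (cycle_edges C))" "e \<in> E" "e \<notin> cycle_edges C"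
proof -
  note J = cycle_Jordan[OF assms(1)]
  show eE: "e \<in> E" using assms by (simp add: inner_edges_def)
  have m: "\<gamma> e (1/2) \<in> inside (drawn (cycle_edges C))" using assms by (simp add: inner_edges_def)
  show nc: "e \<notin> cycle_edges C"
  proof
    assume "e \<in> cycle_edges C"
    then have "\<gamma> e (1/2) \<in> drawn (cycle_edges C)" 
      using midpoint_in_open_arc[of e] path_image_edge[OF eE] by (auto simp: drawn_def)
    then show False using m inside_no_overlap by blast
  qed
  have sub: "open_arc e \<subseteq> inside (drawn (cycle_edges C)) \<union> outside (drawn (cycle_edges C))"
    using open_arc_off_cycle[OF assms(1) eE nc] J(9) by blast
  have "inside (drawn (cycle_edges C)) \<inter> open_arc e = {} \<or> outside (drawn (cycle_edges C)) \<inter> open_arc e = {}"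
    using connectedD[OF open_arc_connected[OF eE] J(2) J(4)] J(8) sub by blast
  then show "open_arc e \<subseteq> inside (drawn (cycle_edges C))"
    using sub m midpoint_in_open_arc[of e] by blast
qed

lemma inner_edgesI:
  assumes "is_cycle E C" "e \<in> E" "e \<notin> cycle_edges C" "open_arc e \<inter> inside (drawn (cycle_edges C)) \<noteq> {}"
  shows "e \<in> inner_edges C"
proof -
  note J = cycle_Jordan[OF assms(1)]
  have sub: "open_arc e \<subseteq> inside (drawn (cycle_edges C)) \<union> outside (drawn (cycle_edges C))"
    using open_arc_off_cycle[OF assms(1-3)] J(9) by blast
  have "inside (drawn (cycle_edges C)) \<inter> open_arc e = {} \<or> outside (drawn (cycle_edges C)) \<inter> open_arc e = {}"
    using connectedD[OF open_arc_connected[OF assms(2)] J(2) J(4)] J(8) sub by blast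
  then have "\<gamma> e (1/2) \<in> inside (drawn (cycle_edges C))" using assms(4) sub midpoint_in_open_arc[of e] by blast
  then show ?thesis using assms by (simp add: inner_edges_def)
qed

text \<open>
  The arc of an inner edge stays in the inside, so its ends lie in the closure of the inside, which adds
  only the cycle itself.
\<close>

lemma inner_edge_ends:
  assumes "is_cycle E C" "e \<in> inner_edges C" "v \<in> e"
  shows "v \<in> set C \<or> v \<in> inner_verts C"
proof -
  note J = cycle_Jordan[OF assms(1)] and e = inner_edge_arc[OF assms(1,2)]
  have vV: "v \<in> V" using e edge_sub assms by auto
  have "p v \<in> closure (inside (drawn (cycle_edges C)))"
    using ends_in_closure_open_arc[OF e(2)] closure_mono[OF e(1)] assms(3) by auto
  then have "p v \<in> inside (drawn (cycle_edges C)) \<union> drawn (cycle_edges C)"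
    using J(10) by (simp add: closure_Un_frontier)
  then show ?thesis using vertex_on_cycle[OF assms(1) vV] vV by (auto simp: inner_verts_def)
qed

lemma inner_vert_not_on_cycle: "is_cycle E C \<Longrightarrow> v \<in> inner_verts C \<Longrightarrow> v \<notin> set C"
  using vertex_on_cycle[of C v] inside_no_overlap unfolding inner_verts_def by blast

lemma edge_at_inner_vert:
  assumes "is_cycle E C" "e \<in> E" "v \<in> e" "v \<in> inner_verts C"
  shows "e \<in> inner_edges C"
proof (rule inner_edgesI[OF assms(1,2)])
  note J = cycle_Jordan[OF assms(1)]
  show "e \<notin> cycle_edges C"
    using inner_vert_not_on_cycle[OF assms(1,4)] assms(1,3) Union_cycle_edges[of C] by (auto simp: is_cycle_def)
  have "p v \<in> closure (open_arc e)" using ends_in_closure_open_arc[OF assms(2)] assms(3) by auto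
  moreover have "p v \<in> inside (drawn (cycle_edges C))" using assms(4) by (simp add: inner_verts_def)
  ultimately show "open_arc e \<inter> inside (drawn (cycle_edges C)) \<noteq> {}"
    using J(2) by (meson closure_iff_nhds_not_empty disjoint_iff subset_refl)
qed

end

section \<open>Edges enclosed by a cycle\<close>

text \<open>
  Extending a path by one step and cutting it back whenever the new vertex already occurs keeps it
  repetition-free.
\<close>

lemma distinct_reach_path:
  assumes "(x, y) \<in> {(u, w). u \<in> I \<and> w \<in> I \<and> {u, w} \<in> E}\<^sup>*" "x \<in> I"
  shows "\<exists>ws. ws \<noteq> [] \<and> hd ws = x \<and> last ws = y \<and> distinct ws \<and> set ws \<subseteq> I \<and> walk_edges ws \<subseteq> E"
  using assms(1)
proof (induction rule: rtrancl_induct)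
  case base
  show ?case using assms(2) by (intro exI[of _ "[x]"]) auto
next
  case (step y z)
  then obtain ws where ws: "ws \<noteq> []" "hd ws = x" "last ws = y" "distinct ws" "set ws \<subseteq> I"
    "walk_edges ws \<subseteq> E" by auto
  show ?case
  proof (cases "z \<in> set ws")
    case True
    then obtain us vs where uv: "ws = us @ z # vs" by (meson split_list)
    then have "walk_edges (us @ [z]) \<subseteq> E" using walk_edges_append[of us z vs] ws(6) by auto
    moreover have "hd (us @ [z]) = x" using uv ws(2) by (cases us) auto
    ultimately show ?thesis using uv ws by (intro exI[of _ "us @ [z]"]) auto
  next
    case False
    obtain us where us: "ws = us @ [y]" using ws(1,3) by (metis append_butlast_last_id)
    have "walk_edges (ws @ [z]) \<subseteq> E"
      using walk_edges_append[of us y "[z]"] us ws(6) step(2) by auto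
    then show ?thesis using ws False step(2) by (intro exI[of _ "ws @ [z]"]) auto
  qed
qed

context plane_graph
begin

lemma subgraph:
  assumes "V' \<subseteq> V" "E' \<subseteq> E" "\<Union>E' \<subseteq> V'"
  shows "plane_graph V' E' p \<gamma>"
proof
  show "fin_graph (V', E')"
    using assms fin finite_subset unfolding fin_graph_def by auto
  have "inj_on p V'" using p_inj assms(1) inj_on_subset by blast
  moreover have "p ` V' \<subseteq> p ` V" using assms(1) by auto
  ultimately show "plane_drawing (V', E') p \<gamma>"
    unfolding plane_drawing_def fst_conv snd_conv
  proof (intro conjI ballI impI)
    fix e assume e: "e \<in> E'"
    then have "e \<in> E" using assms(2) by auto
    then show "arc (\<gamma> e)" "{pathstart (\<gamma> e), pathfinish (\<gamma> e)} = p ` e"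
      by (rule edge_arc, rule ends)
    show "open_arc e \<inter> p ` V' = {}" using open_arc_verts[OF \<open>e \<in> E\<close>] \<open>p ` V' \<subseteq> p ` V\<close> by blast
    fix f assume "f \<in> E'" "f \<noteq> e"
    then show "open_arc e \<inter> path_image (\<gamma> f) = {}" using open_arc_other[OF \<open>e \<in> E\<close>] assms(2) by auto
  qed
qed

text \<open>
  The three walks between \<open>a\<close> and \<open>b\<close> form a theta curve, whose middle arc divides the inside of the
  outer two into the insides of the two new cycles.
\<close>

lemma ear_split:
  assumes C: "is_cycle E C" and ab: "a \<in> set C" "b \<in> set C" "a \<noteq> b"
    and ws: "distinct ws" "set ws \<subseteq> inner_verts C" "walk_edges (a # ws @ [b]) \<subseteq> inner_edges C"
  obtains C1 C2 where "is_cycle E C1" "is_cycle E C2"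
    "length C1 + length C2 = length C + 2 * length ws + 2"
    "inner_edges C \<subseteq> inner_edges C1 \<union> inner_edges C2 \<union> walk_edges (a # ws @ [b])"
    "inner_edges C1 \<union> inner_edges C2 \<subseteq> inner_edges C - walk_edges (a # ws @ [b])"
    "inner_verts C1 \<inter> inner_verts C2 = {}" "inner_verts C1 \<union> inner_verts C2 \<union> set ws \<subseteq> inner_verts C"
    "set ws \<inter> (inner_verts C1 \<union> inner_verts C2) = {}"
proof -
  define W where "W = walk_edges (a # ws @ [b])"
  obtain ys zs where yz: "cycle_edges C = walk_edges (a # ys @ [b]) \<union> walk_edges (a # rev zs @ [b])"
    "set C = set (a # ys @ b # zs)" "length C = length ys + length zs + 2"
    "distinct (a # ys @ b # zs)" "ys \<noteq> [] \<or> zs \<noteq> []"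
    using cycle_as_two_walks[OF C ab] by metis
  have off: "set ws \<inter> set C = {}" using inner_vert_not_on_cycle[OF C] ws(2) by auto
  have sE: "walk_edges (a # ys @ [b]) \<subseteq> E" "walk_edges (a # rev zs @ [b]) \<subseteq> E"
    using yz(1) C by (auto simp: is_cycle_def)
  have WE: "W \<subseteq> E" using ws(3) by (auto simp: W_def inner_edges_def)
  have Wcyc: "W \<inter> cycle_edges C = {}" using inner_edge_arc(3)[OF C] ws(3) by (auto simp: W_def)
  have dist: "distinct (a # us @ b # rev ws)" if "set us \<subseteq> set C - {a, b}" "distinct us" for us
    using that ws(1) off ab by auto
  have ysC: "set ys \<subseteq> set C - {a, b}" "distinct ys" "set (rev zs) \<subseteq> set C - {a, b}" "distinct (rev zs)"
    using yz(2,4) by auto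
  have d: "distinct (a # ys @ b # rev ws)" "distinct (a # rev zs @ b # rev ws)"
    using dist ysC by blast+
  have long: "us \<noteq> [] \<or> ws \<noteq> []" if "walk_edges (a # us @ [b]) \<subseteq> cycle_edges C" for us
    using that Wcyc by (auto simp: W_def)
  obtain g where g: "arc g" "pathstart g = p a" "pathfinish g = p b"
    "path_image g = drawn (walk_edges (a # ys @ [b]))"
    using walk_arc[of "a # ys @ [b]"] yz sE by auto
  obtain h where h: "arc h" "pathstart h = p a" "pathfinish h = p b"
    "path_image h = drawn (walk_edges (a # rev zs @ [b]))"
    using walk_arc[of "a # rev zs @ [b]"] yz sE by auto
  obtain w where w: "arc w" "pathstart w = p a" "pathfinish w = p b"
    "path_image w = drawn W"
    using walk_arc[of "a # ws @ [b]"] d(1) WE by (auto simp: W_def)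
  have Un: "\<Union>(walk_edges (a # us @ [b])) = set (a # us @ [b])" for us
    by (rule Union_walk_edges) simp
  have gh: "path_image g \<inter> path_image h = {p a, p b}"
  proof -
    have "path_image g \<inter> path_image h = p ` (set (a # ys @ [b]) \<inter> set (a # rev zs @ [b]))"
      unfolding g h
      using drawn_Int[OF sE] walk_edges_disjoint[of a ys b "rev zs"] yz(4,5) Un by auto
    also have "\<dots> = {p a, p b}" using yz(4) by auto
    finally show ?thesis .
  qed
  have gw: "path_image g \<inter> path_image w = {p a, p b}"
  proof -
    have "path_image g \<inter> path_image w = p ` (set (a # ys @ [b]) \<inter> set (a # ws @ [b]))"
      unfolding g w using drawn_Int[OF sE(1) WE] Wcyc yz(1) Un[of ys] Un[of ws] by (auto simp: W_def)
    also have "\<dots> = {p a, p b}" using d(1) by auto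
    finally show ?thesis .
  qed
  have hw: "path_image h \<inter> path_image w = {p a, p b}"
  proof -
    have "path_image h \<inter> path_image w = p ` (set (a # rev zs @ [b]) \<inter> set (a # ws @ [b]))"
      unfolding h w using drawn_Int[OF sE(2) WE] Wcyc yz(1) Un[of "rev zs"] Un[of ws] by (auto simp: W_def)
    also have "\<dots> = {p a, p b}" using d(2) by auto
    finally show ?thesis .
  qed
  have J: "path_image g \<union> path_image h = drawn (cycle_edges C)" using g h yz(1) by (simp add: drawn_Un)
  obtain e where e: "e \<in> W" by (cases ws) (auto simp: W_def)
  then have "open_arc e \<subseteq> inside (drawn (cycle_edges C))" "e \<in> E"
    using inner_edge_arc[OF C] ws(3) by (auto simp: W_def)
  moreover have "open_arc e \<subseteq> path_image w"
    using w(4) e path_image_edge[OF \<open>e \<in> E\<close>] by (auto simp: drawn_def)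
  ultimately have ne: "path_image w \<inter> inside (path_image g \<union> path_image h) \<noteq> {}"
    unfolding J using midpoint_in_open_arc[of e] by blast
  have pab: "p a \<noteq> p b" using g arc_distinct_ends by metis
  define C1 where "C1 = a # ys @ b # rev ws"
  define C2 where "C2 = a # rev zs @ b # rev ws"
  have cyc1: "cycle_edges C1 = walk_edges (a # ys @ [b]) \<union> W" and cyc2: "cycle_edges C2 = walk_edges (a # rev zs @ [b]) \<union> W"
    unfolding C1_def C2_def W_def cycle_edges_rev_part by simp_all
  have split: "inside (drawn (cycle_edges C1)) \<inter> inside (drawn (cycle_edges C2)) = {}"
    "inside (drawn (cycle_edges C1)) \<union> inside (drawn (cycle_edges C2)) \<union> (drawn W - {p a, p b}) = inside (drawn (cycle_edges C))"
    unfolding J[symmetric] cyc1 cyc2 drawn_Un g(4)[symmetric] h(4)[symmetric] w(4)[symmetric]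
    using split_inside_simple_closed_curve[OF arc_imp_simple_path[OF g(1)] g(2,3)
        arc_imp_simple_path[OF h(1)] h(2,3) arc_imp_simple_path[OF w(1)] w(2,3) pab gh gw hw ne]
    by blast+
  have good: "is_cycle E C1" "is_cycle E C2"
    unfolding is_cycle_def cyc1 cyc2
    using d sE WE long[of ys] long[of "rev zs"] yz(1)
    by (auto simp: C1_def C2_def Suc_le_eq)
  have "inner_edges C \<subseteq> inner_edges C1 \<union> inner_edges C2 \<union> W"
  proof
    fix f assume f: "f \<in> inner_edges C"
    then have fE: "f \<in> E" by (simp add: inner_edges_def)
    \<comment> \<open>A midpoint on the ear belongs to an edge of the ear, as open arcs avoid all other arcs.\<close>
    have "f \<in> W" if m: "\<gamma> f (1/2) \<in> drawn W"
    proof -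
      obtain k where k: "k \<in> W" "\<gamma> f (1/2) \<in> path_image (\<gamma> k)" using m by (auto simp: drawn_def)
      then have "k = f" using open_arc_other[OF fE, of k] WE midpoint_in_open_arc[of f] by blast
      then show ?thesis using k by simp
    qed
    moreover have "\<gamma> f (1/2) \<in> inside (drawn (cycle_edges C1)) \<union> inside (drawn (cycle_edges C2)) \<union> (drawn W - {p a, p b})"
      using f split(2) by (simp add: inner_edges_def)
    ultimately show "f \<in> inner_edges C1 \<union> inner_edges C2 \<union> W" using fE by (auto simp: inner_edges_def)
  qed
  moreover have "inner_edges C1 \<union> inner_edges C2 \<subseteq> inner_edges C - W"
  proof -
    have "inner_edges C1 \<union> inner_edges C2 \<subseteq> inner_edges C" using split(2) by (auto simp: inner_edges_def)
    moreover have "(inner_edges C1 \<union> inner_edges C2) \<inter> W = {}"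
      using inner_edge_arc(3)[OF good(1)] inner_edge_arc(3)[OF good(2)] cyc1 cyc2 by blast
    ultimately show ?thesis by blast
  qed
  moreover have "inner_verts C1 \<inter> inner_verts C2 = {}" using split(1) by (auto simp: inner_verts_def)
  moreover have "inner_verts C1 \<union> inner_verts C2 \<union> set ws \<subseteq> inner_verts C"
    using split(2) ws(2) by (auto simp: inner_verts_def)
  moreover have "set ws \<inter> (inner_verts C1 \<union> inner_verts C2) = {}"
    using inner_vert_not_on_cycle[OF good(1)] inner_vert_not_on_cycle[OF good(2)] unfolding C1_def C2_def by fastforce
  moreover have "length C1 + length C2 = length C + 2 * length ws + 2"
    using yz(3) by (simp add: C1_def C2_def)
  ultimately show ?thesis using that good unfolding W_def by blast
qed

end

definition has_ear :: "'a set set \<Rightarrow> 'a set \<Rightarrow> 'a list \<Rightarrow> bool" where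
  "has_ear D I C \<longleftrightarrow> (\<exists>a b ws. a \<in> set C \<and> b \<in> set C \<and> a \<noteq> b \<and> distinct ws \<and> set ws \<subseteq> I \<and>
     walk_edges (a # ws @ [b]) \<subseteq> D)"

lemma edge_other_end:
  assumes "card e = 2" "u \<in> e" obtains w where "e = {u, w}" "w \<noteq> u"
  using assms by (auto simp: card_2_iff)

text \<open>
  \<open>K\<close> is the component of \<open>x\<close> among the inner vertices and \<open>N\<close> is the set of its neighbours on the
  cycle. Two different neighbours could be connected through \<open>K\<close>, which would be an ear.
\<close>

lemma (in plane_graph) earless_attachment:
  assumes C: "is_cycle E C" and no: "\<not> has_ear (inner_edges C) (inner_verts C) C" and x: "x \<in> inner_verts C"
  obtains K N where "x \<in> K" "K \<subseteq> inner_verts C" "N \<subseteq> set C" "card N \<le> 1"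
    "\<And>e. e \<in> E \<Longrightarrow> e \<inter> K \<noteq> {} \<Longrightarrow> e \<subseteq> K \<union> N"
proof -
  define R where "R = {(u, w). u \<in> inner_verts C \<and> w \<in> inner_verts C \<and> {u, w} \<in> E}"
  define K where "K = R\<^sup>* `` {x}"
  define N where "N = {a \<in> set C. \<exists>u\<in>K. {a, u} \<in> E}"
  have symR: "sym (R\<^sup>*)"
    by (rule sym_rtrancl) (auto simp: R_def sym_def insert_commute)
  have Kv: "K \<subseteq> inner_verts C"
  proof
    fix y assume "y \<in> K"
    then have "(x, y) \<in> R\<^sup>*" by (simp add: K_def)
    then show "y \<in> inner_verts C" using x by (induction) (auto simp: R_def)
  qed
  have "a = b" if ab: "a \<in> N" "b \<in> N" for a b
  proof (rule ccontr)
    assume ne: "a \<noteq> b"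
    obtain u w where uw: "u \<in> K" "{a, u} \<in> E" "w \<in> K" "{b, w} \<in> E"
      using ab by (auto simp: N_def)
    have "(u, x) \<in> R\<^sup>*" using uw(1) symD[OF symR] by (auto simp: K_def)
    moreover have "(x, w) \<in> R\<^sup>*" using uw(3) by (simp add: K_def)
    ultimately have "(u, w) \<in> R\<^sup>*" by (rule rtrancl_trans)
    then obtain ws where ws: "ws \<noteq> []" "hd ws = u" "last ws = w" "distinct ws"
      "set ws \<subseteq> inner_verts C" "walk_edges ws \<subseteq> E"
      using distinct_reach_path[of u w "inner_verts C" E] uw Kv unfolding R_def by blast
    obtain us where us: "ws = us @ [w]" using ws(1,3) by (metis append_butlast_last_id)
    obtain vs where vs: "ws = u # vs" using ws(1,2) by (cases ws) auto
    have "walk_edges (a # ws @ [b]) = insert {a, u} (walk_edges (ws @ [b]))" using vs by simp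
    also have "walk_edges (ws @ [b]) = walk_edges ws \<union> {{w, b}}"
      using walk_edges_append[of us w "[b]"] us by simp
    finally have st: "walk_edges (a # ws @ [b]) = insert {a, u} (walk_edges ws \<union> {{w, b}})" .
    have "walk_edges (a # ws @ [b]) \<subseteq> inner_edges C"
    proof
      fix e assume e: "e \<in> walk_edges (a # ws @ [b])"
      have eE: "e \<in> E" using e st ws(6) uw by (auto simp: insert_commute)
      have "\<exists>v\<in>e. v \<in> inner_verts C"
      proof -
        have "e = {a, u} \<or> e = {w, b} \<or> e \<subseteq> set ws"
          using e st Union_walk_edges_subset[of ws] by auto
        moreover have "e \<noteq> {}" using edge_card[OF eE] by auto
        ultimately show ?thesis using uw Kv ws(5) by blast
      qed
      then show "e \<in> inner_edges C" using edge_at_inner_vert[OF C eE] by auto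
    qed
    then have "has_ear (inner_edges C) (inner_verts C) C"
      unfolding has_ear_def using ab ne ws(4,5) unfolding N_def by blast
    then show False using no by simp
  qed
  then have "card N \<le> 1"
    using card_le_Suc0_iff_eq[of N] by (simp add: N_def)
  moreover have "e \<subseteq> K \<union> N" if e: "e \<in> E" "e \<inter> K \<noteq> {}" for e
  proof -
    obtain u where u: "u \<in> e" "u \<in> K" using e by auto
    then obtain w where w: "e = {u, w}" using edge_other_end[OF edge_card[OF e(1)] u(1)] by metis
    have "e \<in> inner_edges C" using edge_at_inner_vert[OF C e(1) u(1)] u Kv by auto
    then have "w \<in> set C \<or> w \<in> inner_verts C" using inner_edge_ends[OF C] w by auto
    then have "w \<in> N \<or> w \<in> K"
    proof
      assume "w \<in> set C" then show ?thesis using u w e by (auto simp: N_def insert_commute)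
    next
      assume "w \<in> inner_verts C"
      then have "(u, w) \<in> R" using u Kv w e by (auto simp: R_def)
      then show ?thesis using u unfolding K_def by (auto intro: rtrancl_into_rtrancl)
    qed
    then show ?thesis using u w by auto
  qed
  ultimately show ?thesis using that[of K N] Kv by (auto simp: K_def N_def)
qed

text \<open>
  The hypothesis \<open>IH\<close> is the edge bound for graphs with fewer vertices. The count for an ear with \<open>w\<close>
  inner vertices balances exactly: the two new cycles have total length \<open>l + 2 w + 2\<close>, their bounds
  contribute \<open>- 6\<close> instead of \<open>- 3\<close>, the ear itself has \<open>w + 1\<close> edges, and its \<open>w\<close> vertices are no
  longer inner vertices; indeed \<open>2 w + 2 - 3 + (w + 1) = 3 w\<close>. Without an ear, a component \<open>K\<close> together
  with its only attachment has at most \<open>3 (|K| + 1) - 3 = 3 |K|\<close> edges, and deleting \<open>K\<close> reduces the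
  claim to a smaller graph with the same cycle.
\<close>

lemma inner_edges_bound:
  assumes "plane_graph V E p \<gamma>" "is_cycle E C" "card V \<le> N"
    and IH: "\<And>V' E'. plane_graph V' E' p \<gamma> \<Longrightarrow> V' \<noteq> {} \<Longrightarrow> card V' < N \<Longrightarrow> card E' + 3 \<le> 3 * card V'"
  shows "card (plane_graph.inner_edges E \<gamma> C) + 3 \<le> 3 * card (plane_graph.inner_verts V p \<gamma> C) + length C"
  using assms(1-3)
proof (induction "card V + card (plane_graph.inner_edges E \<gamma> C)" arbitrary: V E C rule: less_induct)
  case less
  interpret plane_graph V E p \<gamma> by fact
  note C = \<open>is_cycle E C\<close>
  have fein: "finite (inner_edges D)" for D using finE by (simp add: inner_edges_def)
  have fvin: "finite (inner_verts D)" for D using finV by (simp add: inner_verts_def)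
  show ?case
  proof (cases "has_ear (inner_edges C) (inner_verts C) C")
    case True
    then obtain a b ws where ear: "a \<in> set C" "b \<in> set C" "a \<noteq> b" "distinct ws" "set ws \<subseteq> inner_verts C"
      "walk_edges (a # ws @ [b]) \<subseteq> inner_edges C" unfolding has_ear_def by blast
    define W where "W = walk_edges (a # ws @ [b])"
    obtain C1 C2 where S: "is_cycle E C1" "is_cycle E C2"
      "length C1 + length C2 = length C + 2 * length ws + 2"
      "inner_edges C \<subseteq> inner_edges C1 \<union> inner_edges C2 \<union> W"
      "inner_edges C1 \<union> inner_edges C2 \<subseteq> inner_edges C - W"
      "inner_verts C1 \<inter> inner_verts C2 = {}" "inner_verts C1 \<union> inner_verts C2 \<union> set ws \<subseteq> inner_verts C"
      "set ws \<inter> (inner_verts C1 \<union> inner_verts C2) = {}"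
      using ear_split[OF C ear] unfolding W_def by metis
    have "W \<noteq> {}" by (cases ws) (auto simp: W_def)
    then have "inner_edges C1 \<subset> inner_edges C" "inner_edges C2 \<subset> inner_edges C" using S(5) ear(6) unfolding W_def by blast+
    then have lt: "card (inner_edges C1) < card (inner_edges C)" "card (inner_edges C2) < card (inner_edges C)"
      using psubset_card_mono[OF fein] by auto
    have "card (inner_edges C) \<le> card (inner_edges C1 \<union> inner_edges C2 \<union> W)"
      by (rule card_mono) (use S(4) fein in \<open>auto simp: W_def\<close>)
    also have "\<dots> \<le> card (inner_edges C1) + card (inner_edges C2) + card W"
      by (meson card_Un_le add_le_mono1 order_trans)
    also have "card W = length ws + 1"
      unfolding W_def
      by (subst card_walk_edges) (use ear inner_vert_not_on_cycle[OF C] in auto)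
    finally have c1: "card (inner_edges C) \<le> card (inner_edges C1) + card (inner_edges C2) + (length ws + 1)" .
    have "card (inner_verts C1 \<union> inner_verts C2 \<union> set ws) = card (inner_verts C1) + card (inner_verts C2) + length ws"
      using S(6,8) fvin distinct_card[OF ear(4)] by (subst card_Un_disjoint; auto simp: card_Un_disjoint)
    then have c2: "card (inner_verts C1) + card (inner_verts C2) + length ws \<le> card (inner_verts C)"
      using card_mono[OF fvin S(7)] by simp
    have "card (inner_edges C1) + 3 \<le> 3 * card (inner_verts C1) + length C1"
      using less(1)[of V E C1] lt S less.prems by simp
    moreover have "card (inner_edges C2) + 3 \<le> 3 * card (inner_verts C2) + length C2"
      using less(1)[of V E C2] lt S less.prems by simp
    ultimately show ?thesis using c1 c2 S(3) by linarith
  next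
    case no: False
    show ?thesis
    proof (cases "inner_verts C = {}")
      case True
      \<comment> \<open>An inner edge would be a chord, that is, an ear without inner vertices.\<close>
      have "inner_edges C = {}"
      proof (rule ccontr)
        assume "inner_edges C \<noteq> {}"
        then obtain e where e: "e \<in> inner_edges C" by auto
        then have "e \<in> E" by (simp add: inner_edges_def)
        then obtain u w where uw: "e = {u, w}" "u \<noteq> w" using edge_card by (meson card_2_iff)
        then have "u \<in> set C" "w \<in> set C" using inner_edge_ends[OF C e] True by auto
        then have "has_ear (inner_edges C) (inner_verts C) C"
          unfolding has_ear_def using uw e
          by (intro exI[of _ u] exI[of _ w] exI[of _ "[]"]) auto
        then show False using no by simp
      qed
      then show ?thesis using C by (simp add: is_cycle_def)
    next
      case False
      then obtain x where x: "x \<in> inner_verts C" by auto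
      obtain K N' where KN: "x \<in> K" "K \<subseteq> inner_verts C" "N' \<subseteq> set C" "card N' \<le> 1"
        "\<And>e. e \<in> E \<Longrightarrow> e \<inter> K \<noteq> {} \<Longrightarrow> e \<subseteq> K \<union> N'"
        using earless_attachment[OF C no x] by metis
      define E' where "E' = {e \<in> E. e \<inter> K \<noteq> {}}"
      have KC: "K \<inter> set C = {}" using KN(2) inner_vert_not_on_cycle[OF C] by auto
      have CV: "set C \<subseteq> V"
        using C Union_cycle_edges[of C] edge_sub unfolding is_cycle_def by blast
      have KV: "K \<subseteq> V" using KN(2) by (auto simp: inner_verts_def)
      have fK: "finite K" "finite N'" using finV KV KN(3) finite_subset by auto
      have cardKN: "card (K \<union> N') = card K + card N'"
        using fK KC KN(3) by (intro card_Un_disjoint) auto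
      have "card (K \<union> set C) = card K + length C"
        using fK KC C by (subst card_Un_disjoint) (auto simp: distinct_card is_cycle_def)
      moreover have "card (K \<union> set C) \<le> card V" using finV KV CV by (intro card_mono) auto
      \<comment> \<open>The cycle has at least three vertices, of which at most one is in the attachment.\<close>
      ultimately have "card (K \<union> N') < N"
        using cardKN KN(4) C less.prems(3) unfolding is_cycle_def by linarith
      moreover have "plane_graph (K \<union> N') E' p \<gamma>"
        using KV KN(3,5) CV by (intro subgraph) (auto simp: E'_def)
      ultimately have "card E' + 3 \<le> 3 * card (K \<union> N')"
        using IH KN(1) by auto
      then have cE': "card E' \<le> 3 * card K" using cardKN KN(4) by linarith
      have pg: "plane_graph (V - K) (E - E') p \<gamma>"
        by (intro subgraph) (use edge_sub in \<open>auto simp: E'_def\<close>)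
      have gc: "is_cycle (E - E') C"
        using C KC Union_cycle_edges[of C] unfolding is_cycle_def E'_def by blast
      have ein': "plane_graph.inner_edges (E - E') \<gamma> C = inner_edges C - E'"
        using pg by (auto simp: inner_edges_def plane_graph.inner_edges_def plane_graph.drawn_def drawn_def)
      have vin': "plane_graph.inner_verts (V - K) p \<gamma> C = inner_verts C - K"
        using pg by (auto simp: inner_verts_def plane_graph.inner_verts_def plane_graph.drawn_def drawn_def)
      have "card (V - K) < card V"
        using finV KV KN(1) by (intro psubset_card_mono) auto
      moreover have "card (inner_edges C - E') \<le> card (inner_edges C)" using fein by (intro card_mono) auto
      ultimately have "card (inner_edges C - E') + 3 \<le> 3 * card (inner_verts C - K) + length C"
        using less(1)[of "V - K" "E - E'" C] pg gc less.prems(3) unfolding ein' vin' by auto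
      moreover have "card (inner_verts C - K) = card (inner_verts C) - card K" "card K \<le> card (inner_verts C)"
        using KN(2) fK fvin by (auto simp: card_Diff_subset card_mono)
      moreover have "card (inner_edges C) \<le> card (inner_edges C - E') + card E'"
      proof -
        have "finite E'" using finE by (simp add: E'_def)
        then have "card (inner_edges C) \<le> card ((inner_edges C - E') \<union> E')"
          using fein by (intro card_mono) auto
        then show ?thesis using card_Un_le[of "inner_edges C - E'" E'] by linarith
      qed
      ultimately show ?thesis using cE' by (simp add: diff_mult_distrib2)
    qed
  qed
qed

section \<open>Planar graphs have at most three edges per vertex\<close>

text \<open>
  The inversion maps the outside of \<open>J\<close> to a punctured neighbourhood of \<open>0\<close> (the image of infinity), and
  it maps the punctured inside of \<open>J\<close> to an unbounded set. Hence the two connected sets \<open>S\<close> and \<open>T\<close>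
  below, which together cover the complement of the image of \<open>J\<close>, are its inside and its outside. The value
  \<open>inverse 0 = 0\<close> makes the map injective on the entire plane.
\<close>

lemma inversion_swaps_sides:
  fixes J :: "complex set"
  assumes J: "connected (inside J)" "open (inside J)" "connected (outside J)" "\<not> bounded (outside J)"
    and a: "a \<in> inside J"
  defines "\<phi> \<equiv> \<lambda>z. inverse (z - a)"
  assumes J': "closed (\<phi> ` J)" "bounded (inside (\<phi> ` J))" "inside (\<phi> ` J) \<noteq> {}"
  shows "z \<in> outside J \<Longrightarrow> \<phi> z \<in> inside (\<phi> ` J)"
    and "z \<in> inside J \<Longrightarrow> z \<noteq> a \<Longrightarrow> \<phi> z \<in> outside (\<phi> ` J)"
proof -
  have inj: "\<phi> x = \<phi> y \<longleftrightarrow> x = y" for x y by (simp add: \<phi>_def)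
  have aJ: "a \<notin> J" "a \<notin> outside J" using a inside_no_overlap inside_Int_outside by blast+
  note side = open_inside[OF J'(1)] open_outside[OF J'(1)]
  have sides: "connected S \<Longrightarrow> S \<inter> \<phi> ` J = {} \<Longrightarrow> S \<subseteq> inside (\<phi> ` J) \<or> S \<subseteq> outside (\<phi> ` J)" for S
  proof -
    assume S: "connected S" "S \<inter> \<phi> ` J = {}"
    then have sub: "S \<subseteq> inside (\<phi> ` J) \<union> outside (\<phi> ` J)"
      using inside_Un_outside[of "\<phi> ` J"] by blast
    have "inside (\<phi> ` J) \<inter> outside (\<phi> ` J) \<inter> S = {}"
      using inside_Int_outside[of "\<phi> ` J"] by blast
    then have "inside (\<phi> ` J) \<inter> S = {} \<or> outside (\<phi> ` J) \<inter> S = {}"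
      using connectedD[OF S(1) side] sub by blast
    then show ?thesis using sub by blast
  qed
  define S where "S = insert 0 (\<phi> ` outside J)"
  define T where "T = \<phi> ` (inside J - {a})"
  have "0 \<in> closure (\<phi> ` outside J)"
  proof (subst closure_approachable, intro allI impI)
    fix \<epsilon> :: real assume eps: "0 < \<epsilon>"
    obtain z where z: "z \<in> outside J" "norm a + 1 / \<epsilon> < norm z"
      using J(4) unfolding bounded_iff by (meson not_le)
    have "1 / \<epsilon> < norm (z - a)" using z(2) norm_triangle_ineq2[of z a] by linarith
    then have "inverse (norm (z - a)) < inverse (1 / \<epsilon>)"
      using eps by (intro less_imp_inverse_less) auto
    then have "dist (\<phi> z) 0 < \<epsilon>"
      by (simp add: \<phi>_def norm_inverse)
    then show "\<exists>y\<in>\<phi> ` outside J. dist y 0 < \<epsilon>" using z by blast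
  qed
  moreover have "connected (\<phi> ` outside J)"
    by (intro connected_continuous_image J(3)) (auto simp: \<phi>_def aJ intro!: continuous_intros)
  ultimately have S: "connected S"
    unfolding S_def by (meson closure_subset connected_intermediate_closure insert_subset subset_insertI)
  have S0: "S \<inter> \<phi> ` J = {}"
    using aJ inj disjoint_iff[THEN iffD1, OF outside_no_overlap[of J]] by (auto simp: S_def \<phi>_def)
  have T: "connected T" unfolding T_def
    by (intro connected_continuous_image connected_open_delete J) (auto simp: \<phi>_def intro!: continuous_intros)
  have T0: "T \<inter> \<phi> ` J = {}"
    using inj disjoint_iff[THEN iffD1, OF inside_no_overlap[of J]] by (auto simp: T_def)
  have "\<not> bounded T"
  proof
    assume "bounded T"
    then obtain B where B: "\<And>w. w \<in> T \<Longrightarrow> norm w \<le> B" by (auto simp: bounded_iff)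
    obtain r where r: "0 < r" "ball a r \<subseteq> inside J" using J(2) a open_contains_ball by metis
    define \<delta> where "\<delta> = min (r / 2) (1 / (\<bar>B\<bar> + 1))"
    have d: "0 < \<delta>" "\<delta> < r" "\<delta> \<le> 1 / (\<bar>B\<bar> + 1)" using r by (auto simp: \<delta>_def)
    define z where "z = a + of_real \<delta>"
    have "z \<in> ball a r" "z \<noteq> a" using d by (auto simp: z_def dist_norm)
    then have "\<phi> z \<in> T" using r by (auto simp: T_def)
    then have "norm (\<phi> z) \<le> B" by (rule B)
    moreover have "norm (\<phi> z) = 1 / \<delta>" using d by (simp add: \<phi>_def z_def norm_inverse inverse_eq_divide norm_divide)
    moreover have "\<bar>B\<bar> + 1 \<le> 1 / \<delta>" using d by (simp add: field_simps)
    ultimately show False by linarith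
  qed
  then have Tout: "T \<subseteq> outside (\<phi> ` J)"
    using sides[OF T T0] J'(2) bounded_subset by blast
  \<comment> \<open>If \<open>S\<close> were in the outside as well, then nothing would be left for the inside.\<close>
  have "- \<phi> ` J \<subseteq> S \<union> T"
  proof
    fix w assume w: "w \<in> - \<phi> ` J"
    show "w \<in> S \<union> T"
    proof (cases "w = 0")
      case False
      define z where "z = a + inverse w"
      have z: "w = \<phi> z" "z \<noteq> a" using False by (auto simp: \<phi>_def z_def)
      then have "z \<in> inside J \<or> z \<in> outside J" using w inside_Un_outside[of J] by blast
      then show ?thesis using z unfolding S_def T_def by blast
    qed (simp add: S_def)
  qed
  then have "\<not> S \<subseteq> outside (\<phi> ` J)"
    using Tout J'(3) inside_Int_outside[of "\<phi> ` J"] inside_no_overlap[of "\<phi> ` J"] by blast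
  then have "S \<subseteq> inside (\<phi> ` J)" using sides[OF S S0] by blast
  then show "z \<in> outside J \<Longrightarrow> \<phi> z \<in> inside (\<phi> ` J)" by (auto simp: S_def)
  show "z \<in> inside J \<Longrightarrow> z \<noteq> a \<Longrightarrow> \<phi> z \<in> outside (\<phi> ` J)" using Tout by (auto simp: T_def)
qed

text \<open>
  An inner point would embed a disc into an interval, contradicting invariance of dimension.
\<close>

lemma interior_arc_image_empty:
  fixes g :: "real \<Rightarrow> complex"
  assumes "arc g"
  shows "interior (path_image g) = {}"
proof (rule ccontr)
  assume "interior (path_image g) \<noteq> {}"
  then obtain x r where r: "0 < r" "ball x r \<subseteq> path_image g"
    by (metis all_not_in_conv mem_interior)
  obtain h where h: "homeomorphism {0..1} (path_image g) g h"
    using homeomorphism_arc[OF assms] by metis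
  have "continuous_on (ball x r) h"
    using h r(2) unfolding homeomorphism_def by (meson continuous_on_subset)
  moreover have "inj_on h (ball x r)"
    using h r(2) unfolding homeomorphism_def by (metis inj_on_def subsetD)
  ultimately have "DIM(complex) \<le> DIM(real)"
    using r(1) by (intro invariance_of_dimension[of "ball x r" h]) auto
  then show False by simp
qed

lemma (in plane_graph) drawn_interior_empty: "F \<subseteq> E \<Longrightarrow> interior (drawn F) = {} \<and> closed (drawn F)"
proof -
  assume F: "F \<subseteq> E"
  then have "finite F" using finE finite_subset by auto
  then show ?thesis using F
  proof (induction F)
    case empty then show ?case by (simp add: drawn_def)
  next
    case (insert e F)
    then have e: "arc (\<gamma> e)" using edge_arc by auto
    have "drawn (insert e F) = drawn F \<union> path_image (\<gamma> e)" by (auto simp: drawn_def)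
    then show ?case
      using insert interior_closed_Un_empty_interior[of "drawn F" "path_image (\<gamma> e)"]
        interior_arc_image_empty[OF e] closed_arc_image[OF e] by auto
  qed
qed

lemma (in plane_graph) homeomorphic_drawing:
  assumes "inj \<phi>" "continuous_on (drawn E) \<phi>"
  shows "plane_graph V E (\<phi> \<circ> p) (\<lambda>e. \<phi> \<circ> \<gamma> e)"
proof
  show "fin_graph (V, E)" by (rule fin)
  show "plane_drawing (V, E) (\<phi> \<circ> p) (\<lambda>e. \<phi> \<circ> \<gamma> e)"
    unfolding plane_drawing_def fst_conv snd_conv
  proof (intro conjI ballI impI)
    show "inj_on (\<phi> \<circ> p) V" using p_inj assms(1) by (meson comp_inj_on inj_on_subset top_greatest)
    fix e assume e: "e \<in> E"
    have c: "continuous_on (path_image (\<gamma> e)) \<phi>"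
      by (rule continuous_on_subset[OF assms(2)]) (use e in \<open>auto simp: drawn_def\<close>)
    have i: "inj_on \<phi> A" for A using assms(1) by (meson inj_on_subset top_greatest)
    show "arc (\<phi> \<circ> \<gamma> e)"
      using edge_arc[OF e] c i unfolding arc_def
      by (auto intro!: path_continuous_image comp_inj_on)
    have "{pathstart (\<phi> \<circ> \<gamma> e), pathfinish (\<phi> \<circ> \<gamma> e)} = \<phi> ` {pathstart (\<gamma> e), pathfinish (\<gamma> e)}"
      by (simp add: pathstart_compose pathfinish_compose)
    then show "{pathstart (\<phi> \<circ> \<gamma> e), pathfinish (\<phi> \<circ> \<gamma> e)} = (\<phi> \<circ> p) ` e"
      using ends[OF e] by (simp add: image_comp)
    show "(\<phi> \<circ> \<gamma> e) ` {0<..<1} \<inter> (\<phi> \<circ> p) ` V = {}"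
      unfolding image_comp[symmetric] image_Int[OF assms(1), symmetric] open_arc_verts[OF e] by simp
    fix f assume f: "f \<in> E" "f \<noteq> e"
    show "(\<phi> \<circ> \<gamma> e) ` {0<..<1} \<inter> path_image (\<phi> \<circ> \<gamma> f) = {}"
      unfolding image_comp[symmetric] path_image_compose image_Int[OF assms(1), symmetric]
        open_arc_other[OF e f] by simp
  qed
qed

text \<open>
  All neighbours of the first vertex of a longest path lie on the path, and one of them is not the second
  vertex.
\<close>

lemma (in plane_graph) cycle_exists:
  assumes "V \<noteq> {}" "\<And>v. v \<in> V \<Longrightarrow> 2 \<le> card {e \<in> E. v \<in> e}"
  obtains C where "is_cycle E C"
proof -
  define L where "L = {xs. xs \<noteq> [] \<and> distinct xs \<and> set xs \<subseteq> V \<and> walk_edges xs \<subseteq> E}"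
  have "length xs \<le> card V" if "xs \<in> L" for xs
    using that distinct_card[of xs] card_mono[OF finV, of "set xs"] by (auto simp: L_def)
  moreover obtain v0 where "v0 \<in> V" using assms(1) by auto
  then have "[v0] \<in> L" by (simp add: L_def)
  ultimately obtain xs where xs: "xs \<in> L" and mx: "\<And>ys. ys \<in> L \<Longrightarrow> length ys \<le> length xs"
    using ex_has_greatest_nat[of "\<lambda>xs. xs \<in> L" "[v0]" length "card V + 1"] by (metis le_imp_less_Suc Suc_eq_plus1 less_imp_le)
  obtain x rest where x: "xs = x # rest" using xs by (cases xs) (auto simp: L_def)
  have "x \<in> V" using xs x by (simp add: L_def)
  then have "2 \<le> card {e \<in> E. x \<in> e}" by (rule assms(2))
  then have "\<not> card {e \<in> E. x \<in> e} \<le> Suc 0" by simp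
  then obtain e1 e2 where e: "e1 \<in> E" "x \<in> e1" "e2 \<in> E" "x \<in> e2" "e1 \<noteq> e2"
    using card_le_Suc0_iff_eq[of "{e \<in> E. x \<in> e}"] finE by auto
  obtain y1 where y1: "e1 = {x, y1}" "y1 \<noteq> x" using edge_other_end[OF edge_card[OF e(1)] e(2)] by metis
  obtain y2 where y2: "e2 = {x, y2}" "y2 \<noteq> x" using edge_other_end[OF edge_card[OF e(3)] e(4)] by metis
  have inrest: "y \<in> set rest" if "{x, y} \<in> E" "y \<noteq> x" for y
  proof (rule ccontr)
    assume "y \<notin> set rest"
    then have "y # xs \<in> L" using xs that edge_sub[OF that(1)] unfolding L_def x by (auto simp: insert_commute)
    then show False using mx by fastforce
  qed
  have "y1 \<noteq> y2" using e y1 y2 by auto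
  then obtain y where y: "{x, y} \<in> E" "y \<noteq> x" "y \<in> set rest" "y \<noteq> hd rest"
    using inrest e y1 y2 by metis
  then obtain us vs where uv: "rest = us @ y # vs" by (meson split_list)
  have "us \<noteq> []" using y(4) uv by auto
  have st: "walk_edges xs = walk_edges (x # us @ [y]) \<union> walk_edges (y # vs)"
    using walk_edges_append[of "x # us" y vs] x uv by simp
  have "cycle_edges (x # us @ [y]) = walk_edges (x # us @ [y]) \<union> {{y, x}}"
    using cycle_edges_split[of x us y "[]"] by simp
  then have "is_cycle E (x # us @ [y])"
    unfolding is_cycle_def using st xs y(1) \<open>us \<noteq> []\<close> x uv
    by (cases us) (auto simp: L_def insert_commute)
  then show ?thesis by (rule that)
qed

text \<open>
  For a graph with a cycle of length \<open>l\<close>, having \<open>i\<close> vertices inside and \<open>j\<close> outside, the two estimates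
  and the cycle give \<open>(3 i + l - 3) + (3 j + l - 3) + l \<le> 3 |V| - 6\<close> edges. The constant \<open>3\<close> in the
  statement is what a single vertex allows; it is also what makes attachments at one vertex free of
  charge in the induction.
\<close>

theorem plane_graph_edge_bound:
  assumes "plane_graph V E p \<gamma>" "V \<noteq> {}"
  shows "card E + 3 \<le> 3 * card V"
  using assms
proof (induction "card V" arbitrary: V E p \<gamma> rule: less_induct)
  case less
  interpret plane_graph V E p \<gamma> by fact
  show ?case
  proof (cases "\<exists>v\<in>V. card {e \<in> E. v \<in> e} \<le> 1")
    case True
    then obtain v where v: "v \<in> V" "card {e \<in> E. v \<in> e} \<le> 1" by auto
    show ?thesis
    proof (cases "V = {v}")
      case True
      have "E = {}"
      proof (rule ccontr)
        assume "E \<noteq> {}"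
        then obtain e where "e \<in> E" by auto
        then have "card e = 2" "e \<subseteq> {v}" using edge_card edge_sub True by auto
        then show False using card_mono[of "{v}" e] by simp
      qed
      then show ?thesis using True by simp
    next
      case False
      have pg: "plane_graph (V - {v}) (E - {e \<in> E. v \<in> e}) p \<gamma>"
        by (intro subgraph) (use edge_sub in auto)
      have "card (V - {v}) < card V" using finV v(1) by (meson card_Diff1_less)
      then have "card (E - {e \<in> E. v \<in> e}) + 3 \<le> 3 * card (V - {v})"
        using less(1)[OF _ pg] False v(1) by auto
      moreover have "card E \<le> card (E - {e \<in> E. v \<in> e}) + card {e \<in> E. v \<in> e}"
        using finE by (subst card_Diff_subset) auto
      moreover have "card (V - {v}) + 1 = card V" using v(1) finV 
        by (metis Suc_eq_plus1 card.remove)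
      ultimately show ?thesis using v(2) by linarith
    qed
  next
    case False
    then have "\<And>v. v \<in> V \<Longrightarrow> 2 \<le> card {e \<in> E. v \<in> e}" by (metis not_less_eq_eq one_add_one plus_1_eq_Suc)
    then obtain C where C: "is_cycle E C" using cycle_exists less.prems(2) by metis
    define J where "J = drawn (cycle_edges C)"
    note J = cycle_Jordan[OF C, folded J_def]
    have IH: "card E' + 3 \<le> 3 * card V'"
      if "plane_graph V' E' p' \<gamma>'" "V' \<noteq> {}" "card V' < card V"
      for V' E' and p' :: "'a \<Rightarrow> complex" and \<gamma>'
      using less(1)[OF that(3,1,2)] .
    have inb: "card (inner_edges C) + 3 \<le> 3 * card (inner_verts C) + length C"
      by (rule inner_edges_bound[OF less.prems(1) C order_refl]) (rule IH)
    \<comment> \<open>The centre of the inversion must avoid the drawing, which is possible as the drawing has no interior.\<close>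
    have emp: "interior (p ` V \<union> drawn E) = {}"
      using drawn_interior_empty[OF order_refl] interior_closed_Un_empty_interior[of "drawn E" "p ` V"]
        finV empty_interior_finite[of "p ` V"] by (simp add: Un_commute)
    have "\<not> inside J \<subseteq> p ` V \<union> drawn E"
      using interior_maximal[OF _ J(2), of "p ` V \<union> drawn E"] emp J(1) by auto
    then obtain a where a: "a \<in> inside J" "a \<notin> p ` V" "a \<notin> drawn E" by auto
    define \<phi> where "\<phi> z = inverse (z - a)" for z
    have inj: "inj \<phi>" by (auto simp: \<phi>_def inj_on_def)
    have cont: "continuous_on (drawn E) \<phi>" unfolding \<phi>_def using a(3)
      by (auto intro!: continuous_intros)
    interpret I: plane_graph V E "\<phi> \<circ> p" "\<lambda>e. \<phi> \<circ> \<gamma> e" by (rule homeomorphic_drawing[OF inj cont])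
    have J'eq: "I.drawn (cycle_edges C) = \<phi> ` J"
      by (simp add: I.drawn_def J_def drawn_def path_image_compose image_UN)
    note J' = I.cycle_Jordan[OF C, unfolded J'eq]
    have outb: "card (I.inner_edges C) + 3 \<le> 3 * card (I.inner_verts C) + length C"
      by (rule inner_edges_bound[OF I.plane_graph_axioms C order_refl]) (rule IH)
    note swap = inversion_swaps_sides[OF J(3,2,5,7) a(1), folded \<phi>_def, OF J'(11,6,1)]
    have "E \<subseteq> cycle_edges C \<union> inner_edges C \<union> I.inner_edges C"
    proof
      fix e assume e: "e \<in> E"
      show "e \<in> cycle_edges C \<union> inner_edges C \<union> I.inner_edges C"
      proof (cases "e \<in> cycle_edges C")
        case False
        then have "\<gamma> e (1/2) \<notin> J" using open_arc_off_cycle[OF C e] midpoint_in_open_arc[of e] unfolding J_def by blast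
        then have "\<gamma> e (1/2) \<in> inside J \<or> \<gamma> e (1/2) \<in> outside J" using J(9) by blast
        then show ?thesis
          using e swap(1) by (auto simp: inner_edges_def I.inner_edges_def J'eq J_def[symmetric])
      qed simp
    qed
    moreover have "finite (cycle_edges C \<union> inner_edges C \<union> I.inner_edges C)"
      using finE by (simp add: cycle_edges_def inner_edges_def I.inner_edges_def)
    ultimately have "card E \<le> card (cycle_edges C \<union> inner_edges C \<union> I.inner_edges C)" by (metis card_mono)
    also have "\<dots> \<le> card (cycle_edges C) + card (inner_edges C) + card (I.inner_edges C)"
      by (meson card_Un_le add_le_mono1 order_trans)
    also have "card (cycle_edges C) = length C" using C by (simp add: card_cycle_edges is_cycle_def)
    finally have cE: "card E \<le> length C + card (inner_edges C) + card (I.inner_edges C)" .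
    have "v \<notin> I.inner_verts C" if "v \<in> inner_verts C" for v
    proof -
      have "p v \<noteq> a" "p v \<in> inside J" using that a(2) by (auto simp: inner_verts_def J_def)
      then have "\<phi> (p v) \<in> outside (\<phi> ` J)" using swap(2) by blast
      then have "\<phi> (p v) \<notin> inside (\<phi> ` J)" using J'(8) by blast
      then show ?thesis by (simp add: I.inner_verts_def J'eq)
    qed
    then have disj: "inner_verts C \<inter> I.inner_verts C = {}" by auto
    have "set C \<inter> (inner_verts C \<union> I.inner_verts C) = {}"
      using inner_vert_not_on_cycle[OF C] I.inner_vert_not_on_cycle[OF C] by auto
    then have "card (set C \<union> (inner_verts C \<union> I.inner_verts C)) = card (set C) + (card (inner_verts C) + card (I.inner_verts C))"
      using disj finV by (subst card_Un_disjoint; simp add: inner_verts_def I.inner_verts_def card_Un_disjoint)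
    moreover have "set C \<subseteq> V"
      using C Union_cycle_edges[of C] edge_sub unfolding is_cycle_def by blast
    then have "card (set C \<union> (inner_verts C \<union> I.inner_verts C)) \<le> card V"
      by (intro card_mono finV) (auto simp: inner_verts_def I.inner_verts_def)
    moreover have "card (set C) = length C" using C by (simp add: distinct_card is_cycle_def)
    ultimately show ?thesis using inb outb cE by linarith
  qed
qed

section \<open>Orientations and colourings from density bounds\<close>

text \<open>
  Hall's theorem for representatives that may be used up to \<open>d\<close> times, by Rado's argument: as long as some
  set contains two elements \<open>x\<close> and \<open>y\<close>, one of them can be removed without violating the condition.
  If both removals failed, witnessed by \<open>I\<close> and \<open>J\<close>, then submodularity of the size of a union would
  violate the condition for \<open>I \<union> J \<union> {e}\<close> or for \<open>I \<inter> J\<close>.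
\<close>

lemma capacitated_choice:
  fixes A :: "'e \<Rightarrow> 'v set"
  assumes "finite E" "\<And>e. e \<in> E \<Longrightarrow> finite (A e)"
    and "\<And>F. F \<subseteq> E \<Longrightarrow> card F \<le> d * card (\<Union>(A ` F))"
  shows "\<exists>t. (\<forall>e\<in>E. t e \<in> A e) \<and> (\<forall>v. card {e \<in> E. t e = v} \<le> d)"
  using assms(2,3)
proof (induction "\<Sum>e\<in>E. card (A e)" arbitrary: A rule: less_induct)
  case less
  have ne: "A e \<noteq> {}" if "e \<in> E" for e
    using less.prems(2)[of "{e}"] that by auto
  show ?case
  proof (cases "\<exists>e\<in>E. \<exists>x\<in>A e. \<exists>y\<in>A e. x \<noteq> y")
    case False
    define t where "t e = (SOME x. x \<in> A e)" for e
    have t: "t e \<in> A e" if "e \<in> E" for e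
      using ne[OF that] unfolding t_def by (simp add: some_in_eq)
    have "card {e \<in> E. t e = v} \<le> d" for v
    proof -
      have "\<Union>(A ` {e \<in> E. t e = v}) \<subseteq> {v}" using False t by blast
      then have "card (\<Union>(A ` {e \<in> E. t e = v})) \<le> 1" using card_mono[of "{v}"] by fastforce
      then have "d * card (\<Union>(A ` {e \<in> E. t e = v})) \<le> d" using mult_le_mono2 by fastforce
      moreover have "card {e \<in> E. t e = v} \<le> d * card (\<Union>(A ` {e \<in> E. t e = v}))"
        by (rule less.prems(2)) auto
      ultimately show ?thesis by linarith
    qed
    then show ?thesis using t by blast
  next
    case True
    then obtain e x y where exy: "e \<in> E" "x \<in> A e" "y \<in> A e" "x \<noteq> y" by blast
    define B where "B z = A(e := A e - {z})" for z
    have small: "(\<Sum>f\<in>E. card (B z f)) < (\<Sum>f\<in>E. card (A f))" if "z \<in> A e" for z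
    proof (rule sum_strict_mono_ex1[OF assms(1)])
      show "\<forall>f\<in>E. card (B z f) \<le> card (A f)"
        using less.prems(1) by (auto simp: B_def intro: card_mono)
      show "\<exists>f\<in>E. card (B z f) < card (A f)"
        using that exy(1) less.prems(1) card_Diff1_less[of "A e" z] by (auto simp: B_def)
    qed
    have fin: "finite (B z f)" if "f \<in> E" for z f using less.prems(1) that by (auto simp: B_def)
    have tight: "\<exists>I. I \<subseteq> E - {e} \<and> d * card (\<Union>(A ` I) \<union> (A e - {z})) \<le> card I"
      if violated: "\<not> (\<forall>F. F \<subseteq> E \<longrightarrow> card F \<le> d * card (\<Union>(B z ` F)))" for z
    proof -
      obtain F where F: "F \<subseteq> E" "d * card (\<Union>(B z ` F)) < card F" using violated by (auto simp: not_le)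
      have "e \<in> F"
      proof (rule ccontr)
        assume "e \<notin> F"
        then have "B z ` F = A ` F" unfolding B_def by (intro image_cong) auto
        then show False using F less.prems(2)[of F] by simp
      qed
      have "B z ` (F - {e}) = A ` (F - {e})" unfolding B_def by (intro image_cong) auto
      then have "\<Union>(B z ` F) = \<Union>(A ` (F - {e})) \<union> (A e - {z})"
        using \<open>e \<in> F\<close> by (subst insert_Diff[OF \<open>e \<in> F\<close>, symmetric]) (auto simp: B_def)
      moreover have "card F = card (F - {e}) + 1"
        using \<open>e \<in> F\<close> finite_subset[OF F(1) assms(1)] by (metis Suc_eq_plus1 card.remove)
      ultimately show ?thesis using F by (intro exI[of _ "F - {e}"]) auto
    qed
    have "\<exists>z\<in>{x, y}. \<forall>F. F \<subseteq> E \<longrightarrow> card F \<le> d * card (\<Union>(B z ` F))"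
    proof (rule ccontr)
      assume "\<not> ?thesis"
      then obtain I J where I: "I \<subseteq> E - {e}" "d * card (\<Union>(A ` I) \<union> (A e - {x})) \<le> card I"
        and J: "J \<subseteq> E - {e}" "d * card (\<Union>(A ` J) \<union> (A e - {y})) \<le> card J"
        using tight[of x] tight[of y] by auto
      define X where "X = \<Union>(A ` I) \<union> (A e - {x})"
      define Y where "Y = \<Union>(A ` J) \<union> (A e - {y})"
      have fIJ: "finite I" "finite J" using I J assms(1) finite_subset by (meson finite_Diff)+
      have fXY: "finite X" "finite Y" using fIJ I J less.prems(1) exy(1) by (auto simp: X_def Y_def)
      have "X \<union> Y = \<Union>(A ` insert e (I \<union> J))" using exy by (auto simp: X_def Y_def)
      then have "card (insert e (I \<union> J)) \<le> d * card (X \<union> Y)"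
        using less.prems(2)[of "insert e (I \<union> J)"] I J exy by auto
      moreover have "card (insert e (I \<union> J)) = card (I \<union> J) + 1"
        using fIJ I J by (subst card_insert_disjoint) auto
      moreover have "card (I \<inter> J) \<le> d * card (X \<inter> Y)"
      proof -
        have "card (I \<inter> J) \<le> d * card (\<Union>(A ` (I \<inter> J)))"
          using less.prems(2)[of "I \<inter> J"] I by auto
        also have "\<dots> \<le> d * card (X \<inter> Y)"
          using fXY by (intro mult_le_mono2 card_mono) (auto simp: X_def Y_def)
        finally show ?thesis .
      qed
      moreover have "d * card (X \<union> Y) + d * card (X \<inter> Y) = d * card X + d * card Y"
        using card_Un_Int[OF fXY] by (metis distrib_left)
      moreover have "card (I \<union> J) + card (I \<inter> J) = card I + card J"
        using card_Un_Int[OF fIJ] by simp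
      ultimately show False using I(2) J(2) unfolding X_def Y_def by linarith
    qed
    then obtain z where z: "z \<in> A e" "\<And>F. F \<subseteq> E \<Longrightarrow> card F \<le> d * card (\<Union>(B z ` F))"
      using exy by auto
    have "\<exists>t. (\<forall>f\<in>E. t f \<in> B z f) \<and> (\<forall>v. card {f \<in> E. t f = v} \<le> d)"
      using less.hyps[OF small[OF z(1)]] fin z(2) by blast
    moreover have "B z f \<subseteq> A f" for f by (auto simp: B_def)
    ultimately show ?thesis by blast
  qed
qed

text \<open>
  Some vertex is in at most \<open>2 C\<close> pairs, by averaging. Colour all other vertices first, then this one.
\<close>

lemma sparse_colouring:
  assumes "finite S" "\<And>T. T \<subseteq> S \<Longrightarrow> card (D \<inter> T \<times> T) \<le> C * card T"
    and irr: "\<And>v. (v, v) \<notin> D"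
  shows "\<exists>\<psi>. (\<forall>v\<in>S. \<psi> v \<le> 2 * C) \<and> (\<forall>u\<in>S. \<forall>w\<in>S. (u, w) \<in> D \<longrightarrow> \<psi> u \<noteq> \<psi> w)"
  using assms(1,2)
proof (induction "card S" arbitrary: S)
  case 0
  then show ?case by auto
next
  case (Suc n)
  define out where "out v = {u \<in> S. (v, u) \<in> D}" for v
  define inn where "inn v = {u \<in> S. (u, v) \<in> D}" for v
  have "(\<Sum>v\<in>S. card (out v)) = card (SIGMA v:S. out v)"
    using Suc.prems by (simp add: card_SigmaI out_def)
  also have "(SIGMA v:S. out v) = D \<inter> S \<times> S" by (auto simp: out_def)
  finally have so: "(\<Sum>v\<in>S. card (out v)) \<le> C * card S" using Suc.prems(2)[of S] by simp
  have "(\<Sum>v\<in>S. card (inn v)) = card (SIGMA v:S. inn v)"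
    using Suc.prems by (simp add: card_SigmaI inn_def)
  also have "\<dots> = card (prod.swap ` (SIGMA v:S. inn v))" by (simp add: card_image)
  also have "prod.swap ` (SIGMA v:S. inn v) = D \<inter> S \<times> S" by (force simp: inn_def)
  finally have si: "(\<Sum>v\<in>S. card (inn v)) \<le> C * card S" using Suc.prems(2)[of S] by simp
  have "\<exists>v\<in>S. card (out v) + card (inn v) \<le> 2 * C"
  proof (rule ccontr)
    assume "\<not> ?thesis"
    then have "\<And>v. v \<in> S \<Longrightarrow> 2 * C + 1 \<le> card (out v) + card (inn v)" by force
    then have "(\<Sum>v\<in>S. 2 * C + 1) \<le> (\<Sum>v\<in>S. card (out v) + card (inn v))" by (rule sum_mono)
    then have "card S + 2 * (C * card S) \<le> 2 * (C * card S)"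
      using so si by (simp add: sum.distrib mult.left_commute mult.commute)
    then show False using Suc.hyps(2) by simp
  qed
  then obtain v where v: "v \<in> S" "card (out v) + card (inn v) \<le> 2 * C" by auto
  have "n = card (S - {v})" "finite (S - {v})" using Suc.hyps(2) Suc.prems v by auto
  moreover have "card (D \<inter> T \<times> T) \<le> C * card T" if "T \<subseteq> S - {v}" for T
    using Suc.prems(2)[of T] that by blast
  ultimately obtain \<psi> where \<psi>: "\<forall>u\<in>S - {v}. \<psi> u \<le> 2 * C"
    "\<forall>u\<in>S - {v}. \<forall>w\<in>S - {v}. (u, w) \<in> D \<longrightarrow> \<psi> u \<noteq> \<psi> w"
    using Suc.hyps(1)[of "S - {v}"] by metis
  have "card (\<psi> ` (out v \<union> inn v)) \<le> card (out v \<union> inn v)"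
    by (rule card_image_le) (use Suc.prems in \<open>auto simp: out_def inn_def\<close>)
  also have "\<dots> \<le> 2 * C" using card_Un_le v(2) le_trans by blast
  finally have "card (\<psi> ` (out v \<union> inn v)) < card {..2 * C}" by simp
  then have "\<not> {..2 * C} \<subseteq> \<psi> ` (out v \<union> inn v)"
    using card_mono[of "\<psi> ` (out v \<union> inn v)" "{..2 * C}"] Suc.prems(1)
    by (auto simp: out_def inn_def)
  then obtain c where c: "c \<le> 2 * C" "c \<notin> \<psi> ` (out v \<union> inn v)" by auto
  show ?case
    by (rule exI[of _ "\<psi>(v := c)"]) (use \<psi> c irr in \<open>auto simp: out_def inn_def\<close>)
qed

lemma planar_iff_plane_graph: "planar (V, E) \<longleftrightarrow> (\<exists>p \<gamma>. plane_graph V E p \<gamma>)"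
  by (auto simp: planar_def plane_graph_def)

context plane_graph
begin

lemma edge_bound: "card E \<le> 3 * card V"
proof (cases "V = {}")
  case True
  then have "E = {}" using edge_sub edge_card by force
  then show ?thesis by simp
next
  case False
  then show ?thesis using plane_graph_edge_bound[OF plane_graph_axioms] by simp
qed

text \<open>
  Each edge \<open>q\<close> of the new graph is drawn along the two edges joining its ends to the vertex \<open>c q\<close>. Distinct
  edges use distinct middle vertices, so the concatenated arcs meet only in common ends.
\<close>

lemma suppress_subdivision:
  assumes S: "S \<subseteq> V" and F: "\<And>q. q \<in> F \<Longrightarrow> q \<subseteq> S \<and> card q = 2"
    and c: "inj_on c F" "\<And>q. q \<in> F \<Longrightarrow> c q \<notin> S" "\<And>q u. q \<in> F \<Longrightarrow> u \<in> q \<Longrightarrow> {u, c q} \<in> E"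
  shows "\<exists>\<delta>. plane_graph S F p \<delta>"
proof -
  define T where "T q = (\<lambda>u. {u, c q}) ` q" for q
  have TE: "T q \<subseteq> E" if "q \<in> F" for q using c(3) that by (auto simp: T_def)
  have UT: "\<Union>(T q) = insert (c q) q" if "q \<in> F" for q
    using F[OF that] by (auto simp: T_def card_2_iff)
  have "\<exists>g. arc g \<and> {pathstart g, pathfinish g} = p ` q \<and> path_image g = drawn (T q)" if q: "q \<in> F" for q
  proof -
    obtain u w where uw: "q = {u, w}" "u \<noteq> w" using F[OF q] by (meson card_2_iff)
    have "c q \<noteq> u" "c q \<noteq> w" using c(2)[OF q] F[OF q] uw by auto
    then obtain g where "arc g" "pathstart g = p u" "pathfinish g = p w"
      "path_image g = drawn (walk_edges [u, c q, w])"
      using walk_arc[of "[u, c q, w]"] uw c(3)[OF q] by (auto simp: insert_commute)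
    moreover have "walk_edges [u, c q, w] = T q" using uw by (auto simp: T_def insert_commute)
    ultimately show ?thesis using uw by (intro exI[of _ g]) simp
  qed
  then obtain \<delta> where \<delta>: "\<And>q. q \<in> F \<Longrightarrow> arc (\<delta> q)"
    "\<And>q. q \<in> F \<Longrightarrow> {pathstart (\<delta> q), pathfinish (\<delta> q)} = p ` q"
    "\<And>q. q \<in> F \<Longrightarrow> path_image (\<delta> q) = drawn (T q)" by metis
  have inner: "\<delta> q ` {0<..<1} = drawn (T q) - p ` q" if "q \<in> F" for q
    using simple_path_endless[OF arc_imp_simple_path[OF \<delta>(1)[OF that]]] \<delta>(2,3)[OF that] by simp
  have disj: "T q \<inter> T r = {}" if qr: "q \<in> F" "r \<in> F" "q \<noteq> r" for q r
  proof (rule ccontr)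
    assume "T q \<inter> T r \<noteq> {}"
    then obtain u u' where u: "u \<in> q" "u' \<in> r" "{u, c q} = {u', c r}" by (auto simp: T_def)
    then have "u \<in> S" "u' \<in> S" using F qr by auto
    then have "c q = c r" using u(3) c(2)[OF qr(1)] c(2)[OF qr(2)] by (auto simp: doubleton_eq_iff)
    then show False using c(1) qr by (auto dest: inj_onD)
  qed
  have "plane_graph S F p \<delta>"
  proof
    show "fin_graph (S, F)" using F S finV finite_subset by (auto simp: fin_graph_def)
    show "plane_drawing (S, F) p \<delta>"
      unfolding plane_drawing_def fst_conv snd_conv
    proof (intro conjI ballI impI)
      show "inj_on p S" using p_inj S inj_on_subset by blast
      fix q assume q: "q \<in> F"
      show "arc (\<delta> q)" "{pathstart (\<delta> q), pathfinish (\<delta> q)} = p ` q" using \<delta> q by auto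
      show "\<delta> q ` {0<..<1} \<inter> p ` S = {}"
      proof (rule ccontr)
        assume "\<delta> q ` {0<..<1} \<inter> p ` S \<noteq> {}"
        then obtain s where s: "s \<in> S" "p s \<in> drawn (T q)" "p s \<notin> p ` q" using inner[OF q] by auto
        then have "s \<in> insert (c q) q"
          using vertex_on_drawn[OF TE[OF q], of s] UT[OF q] S by auto
        then show False using s c(2)[OF q] by auto
      qed
      fix r assume r: "r \<in> F" "r \<noteq> q"
      have "drawn (T q) \<inter> drawn (T r) = p ` (insert (c q) q \<inter> insert (c r) r)"
        using drawn_Int[OF TE[OF q] TE[OF r(1)]] disj[OF q r(1)] r(2) UT[OF q] UT[OF r(1)] by auto
      also have "insert (c q) q \<inter> insert (c r) r = q \<inter> r"
        using F[OF q] F[OF r(1)] c(2)[OF q] c(2)[OF r(1)] inj_onD[OF c(1) _ q r(1)] r(2) by blast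
      finally show "\<delta> q ` {0<..<1} \<inter> path_image (\<delta> r) = {}"
        using inner[OF q] \<delta>(3)[OF r(1)] by auto
    qed
  qed
  then show ?thesis by blast
qed

lemma orientation_outdegree_3:
  obtains t where "\<And>e. e \<in> E \<Longrightarrow> t e \<in> e" "\<And>v. card {e \<in> E. t e = v} \<le> 3"
proof -
  have "card F \<le> 3 * card (\<Union>((\<lambda>e. e) ` F))" if "F \<subseteq> E" for F
  proof -
    have "plane_graph (\<Union>F) F p \<gamma>" by (rule subgraph) (use that edge_sub in auto)
    then interpret F: plane_graph "\<Union>F" F p \<gamma> .
    show ?thesis using F.edge_bound by simp
  qed
  moreover have "finite e" if "e \<in> E" for e using edge_sub[OF that] finV finite_subset by auto
  ultimately have "\<exists>t. (\<forall>e\<in>E. t e \<in> e) \<and> (\<forall>v. card {e \<in> E. t e = v} \<le> 3)"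
    using capacitated_choice[OF finE, of "\<lambda>e. e" 3] by blast
  then show ?thesis using that by blast
qed

end

definition arcs_of :: "'a set set \<Rightarrow> ('a set \<Rightarrow> 'a) \<Rightarrow> ('a \<times> 'a) set" where
  "arcs_of E t = {(u, v). {u, v} \<in> E \<and> t {u, v} = u}"

text \<open>
  The linear order selects one of the two pairs for every two vertices with a common in-neighbour, so that
  these pairs correspond to edges of a simple graph.
\<close>

definition forks :: "('a::linorder \<times> 'a) set \<Rightarrow> ('a \<times> 'a) set" where
  "forks A = {(u, w). u < w \<and> (\<exists>v. (v, u) \<in> A \<and> (v, w) \<in> A)}"

text \<open>
  Pairs for which a fixed vertex of \<open>S\<close> is the first vertex or the centre are bounded by powers of the
  outdegree: \<open>3\<close> for edges, \<open>9\<close> for paths, \<open>9\<close> for forks centred in \<open>S\<close>. Forks centred outside of \<open>S\<close>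
  are bounded by planarity. Assign to each of them a centre; every centre serves at most \<open>9\<close> of them.
  Keeping one fork for each centre gives a graph on \<open>S\<close> whose subdivision is a subgraph of the given
  planar graph, hence at most \<open>3 |S|\<close> forks are kept and there are at most \<open>27 |S|\<close> in total.
\<close>

lemma conflict_sparse:
  fixes V :: "'a::linorder set"
  assumes "plane_graph V E p \<gamma>"
    and out: "\<And>v. card {e \<in> E. t e = v} \<le> 3"
    and S: "S \<subseteq> V"
  defines "A \<equiv> arcs_of E t"
  shows "card ((A \<union> A O A \<union> forks A) \<inter> S \<times> S) \<le> 48 * card S"
proof -
  interpret plane_graph V E p \<gamma> by fact
  have fS: "finite S" using S finV finite_subset by auto
  have AV: "A \<subseteq> V \<times> V" using edge_sub by (auto simp: A_def arcs_of_def)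
  have irr: "u \<noteq> v" if "(u, v) \<in> A" for u v
    using that edge_card[of "{u, v}"] by (auto simp: A_def arcs_of_def)
  define N where "N v = A `` {v}" for v
  have fN: "finite (N v)" for v using AV finV finite_subset[of "N v" V] by (auto simp: N_def)
  have N3: "card (N v) \<le> 3" for v
  proof -
    have "inj_on (\<lambda>w. {v, w}) (N v)" by (auto simp: inj_on_def doubleton_eq_iff)
    moreover have "(\<lambda>w. {v, w}) ` N v \<subseteq> {e \<in> E. t e = v}" by (auto simp: N_def A_def arcs_of_def)
    ultimately have "card (N v) \<le> card {e \<in> E. t e = v}"
      using finE by (intro card_inj_on_le) auto
    then show ?thesis using out[of v] by linarith
  qed
  have NN: "card (N u \<times> N v) \<le> 9" for u v
    using mult_le_mono[OF N3[of u] N3[of v]] by (simp add: card_cartesian_product)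
  have bound: "card (\<Union>v\<in>S. f v) \<le> m * card S" if "\<And>v. card (f v) \<le> m" for f :: "'a \<Rightarrow> ('a \<times> 'a) set" and m
  proof -
    have "card (\<Union>v\<in>S. f v) \<le> (\<Sum>v\<in>S. card (f v))" by (rule card_UN_le[OF fS])
    also have "\<dots> \<le> (\<Sum>v\<in>S. m)" by (rule sum_mono) (rule that)
    finally show ?thesis by (simp add: mult.commute)
  qed
  have one: "card (A \<inter> S \<times> S) \<le> 3 * card S"
  proof -
    have "A \<inter> S \<times> S \<subseteq> (\<Union>v\<in>S. {v} \<times> N v)" by (auto simp: N_def)
    then have "card (A \<inter> S \<times> S) \<le> card (\<Union>v\<in>S. {v} \<times> N v)" using fS fN by (intro card_mono) auto
    also have "\<dots> \<le> 3 * card S" by (rule bound) (simp add: card_cartesian_product N3)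
    finally show ?thesis .
  qed
  have two: "card ((A O A) \<inter> S \<times> S) \<le> 9 * card S"
  proof -
    have "(A O A) \<inter> S \<times> S \<subseteq> (\<Union>v\<in>S. {v} \<times> (\<Union>w\<in>N v. N w))" by (auto simp: N_def)
    then have "card ((A O A) \<inter> S \<times> S) \<le> card (\<Union>v\<in>S. {v} \<times> (\<Union>w\<in>N v. N w))"
      using fS fN by (intro card_mono) auto
    also have "\<dots> \<le> 9 * card S"
    proof (rule bound)
      fix v
      have "card (\<Union>w\<in>N v. N w) \<le> (\<Sum>w\<in>N v. card (N w))" by (rule card_UN_le[OF fN])
      also have "\<dots> \<le> (\<Sum>w\<in>N v. 3)" by (rule sum_mono) (rule N3)
      also have "\<dots> \<le> 9" using N3[of v] by simp
      finally show "card ({v} \<times> (\<Union>w\<in>N v. N w)) \<le> 9" by (simp add: card_cartesian_product)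
    qed
    finally show ?thesis .
  qed
  define P where "P = {(u, w). u < w \<and> u \<in> S \<and> w \<in> S \<and> (\<exists>v. v \<notin> S \<and> u \<in> N v \<and> w \<in> N v)}"
  have "forks A \<inter> S \<times> S \<subseteq> (\<Union>v\<in>S. N v \<times> N v) \<union> P"
    by (auto simp: forks_def N_def P_def)
  moreover have fP: "finite P" by (rule finite_subset[of _ "S \<times> S"]) (use fS in \<open>auto simp: P_def\<close>)
  ultimately have "card (forks A \<inter> S \<times> S) \<le> card ((\<Union>v\<in>S. N v \<times> N v) \<union> P)"
    using fS fN by (intro card_mono) auto
  also have "\<dots> \<le> card (\<Union>v\<in>S. N v \<times> N v) + card P" by (rule card_Un_le)
  also have "card (\<Union>v\<in>S. N v \<times> N v) \<le> 9 * card S" by (rule bound) (rule NN)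
  finally have three: "card (forks A \<inter> S \<times> S) \<le> 9 * card S + card P" by simp
  have four: "card P \<le> 27 * card S"
  proof -
    have "\<forall>q\<in>P. \<exists>v. v \<notin> S \<and> q \<in> N v \<times> N v" by (auto simp: P_def)
    then obtain c where c: "\<And>q. q \<in> P \<Longrightarrow> c q \<notin> S" "\<And>q. q \<in> P \<Longrightarrow> q \<in> N (c q) \<times> N (c q)" by metis
    \<comment> \<open>\<open>Q\<close> keeps one fork for each centre.\<close>
    obtain Q where Q: "Q \<subseteq> P" "c ` P = c ` Q" "inj_on c Q"
      by (metis subset_image_inj order_refl)
    have "card P \<le> card (\<Union>v\<in>c ` P. {q \<in> P. c q = v})" using fP by (intro card_mono) auto
    also have "\<dots> \<le> (\<Sum>v\<in>c ` P. card {q \<in> P. c q = v})" using fP by (intro card_UN_le) auto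
    also have "\<dots> \<le> (\<Sum>v\<in>c ` P. 9)"
    proof (rule sum_mono)
      fix v
      have "card {q \<in> P. c q = v} \<le> card (N v \<times> N v)" using c(2) fN by (intro card_mono) auto
      then show "card {q \<in> P. c q = v} \<le> 9" using NN[of v v] by linarith
    qed
    also have "\<dots> = 9 * card Q" using Q by (simp add: card_image)
    finally have PQ: "card P \<le> 9 * card Q" .
    define pr where "pr = (\<lambda>(u, w). {u, w :: 'a})"
    define F where "F = pr ` Q"
    have injpr: "inj_on pr P" by (auto simp: inj_on_def pr_def P_def doubleton_eq_iff)
    define c' where "c' = (\<lambda>e. c (the_inv_into Q pr e))"
    have injQ: "inj_on pr Q" using injpr Q(1) inj_on_subset by blast
    have c': "c' (pr q) = c q" if "q \<in> Q" for q
      using the_inv_into_f_f[OF injQ that] by (simp add: c'_def)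
    have "\<exists>\<delta>. plane_graph S F p \<delta>"
    proof (rule suppress_subdivision[OF S])
      show "inj_on c' F" unfolding F_def
        using Q(3) c' by (auto simp: inj_on_def)
      show "q \<subseteq> S \<and> card q = 2" if "q \<in> F" for q
        using that Q(1) by (auto simp: F_def pr_def P_def card_insert_if)
      show "c' q \<notin> S" if "q \<in> F" for q using that c' c(1) Q(1) by (auto simp: F_def)
      show "{u, c' q} \<in> E" if q: "q \<in> F" and u: "u \<in> q" for q u
      proof -
        obtain r where r: "r \<in> Q" "q = pr r" using q by (auto simp: F_def)
        then have "u \<in> N (c r)" using u c(2)[of r] Q(1) by (auto simp: pr_def)
        then show ?thesis using c'[OF r(1)] r(2)
          by (auto simp: N_def A_def arcs_of_def insert_commute)
      qed
    qed
    then obtain \<delta> where "plane_graph S F p \<delta>" by blast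
    then have "card F \<le> 3 * card S" by (rule plane_graph.edge_bound)
    moreover have "card F = card Q" using injQ by (simp add: F_def card_image)
    ultimately show ?thesis using PQ by linarith
  qed
  have "card ((A \<union> A O A \<union> forks A) \<inter> S \<times> S)
      \<le> card (A \<inter> S \<times> S) + card ((A O A) \<inter> S \<times> S) + card (forks A \<inter> S \<times> S)"
    unfolding Int_Un_distrib2 by (meson card_Un_le add_le_mono1 order_trans)
  then show ?thesis using one two three four by linarith
qed

section \<open>The upper bound: a universal graph of cubic size\<close>

lemma list_cover:
  assumes "finite A" "card A \<le> n"
  shows "\<exists>xs. length xs = n \<and> A \<subseteq> set xs \<and> set xs \<subseteq> insert d A"
proof -
  obtain ys where "set ys = A" "distinct ys" using finite_distinct_list[OF assms(1)] by auto
  moreover then have "length ys \<le> n" using assms(2) distinct_card by metis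
  ultimately show ?thesis by (intro exI[of _ "ys @ replicate (n - length ys) d"]) auto
qed

text \<open>
  A label consists of the auxiliary colour of a vertex and a list of \<open>d\<close> entries \<open>(j, c)\<close>, read as: the outgoing
  edge towards auxiliary colour \<open>j\<close> has colour \<open>c\<close>.
\<close>

type_synonym label = "nat \<times> (nat \<times> nat) list"

definition link :: "label \<Rightarrow> label \<Rightarrow> nat \<Rightarrow> bool" where
  "link x y c \<longleftrightarrow> (fst y, c) \<in> set (snd x) \<or> (fst x, c) \<in> set (snd y)"

lemma link_sym: "link x y c \<longleftrightarrow> link y x c" by (auto simp: link_def)

definition target_verts :: "nat \<Rightarrow> nat \<Rightarrow> nat \<Rightarrow> label set" where
  "target_verts R d k = {..<R} \<times> {xs. set xs \<subseteq> {..<R} \<times> {1..k} \<and> length xs = d}"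

definition target_edges :: "nat \<Rightarrow> nat \<Rightarrow> nat \<Rightarrow> label set set" where
  "target_edges R d k = {{x, y} |x y. x \<in> target_verts R d k \<and> y \<in> target_verts R d k \<and>
     fst x \<noteq> fst y \<and> (\<exists>c\<in>{1..k}. link x y c)}"

definition target_colour :: "nat \<Rightarrow> label set \<Rightarrow> nat" where
  "target_colour k e = (SOME c. c \<in> {1..k} \<and> (\<exists>x y. e = {x, y} \<and> link x y c))"

definition target :: "nat \<Rightarrow> nat \<Rightarrow> nat \<Rightarrow> label ecgraph" where
  "target R d k = ((target_verts R d k, target_edges R d k), target_colour k)"

lemma card_target_verts: "card (target_verts R d k) = R * (R * k) ^ d"
  unfolding target_verts_def card_cartesian_product
  by (simp add: card_lists_length_eq card_cartesian_product)

lemma finite_target_verts: "finite (target_verts R d k)"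
  unfolding target_verts_def by (auto intro: finite_lists_length_eq)

lemma ec_graph_target: "ec_graph k (target R d k)"
proof -
  have "target_colour k e \<in> {1..k}" if e: "e \<in> target_edges R d k" for e
  proof -
    have "\<exists>c. c \<in> {1..k} \<and> (\<exists>x y. e = {x, y} \<and> link x y c)"
      using e unfolding target_edges_def by blast
    then show ?thesis unfolding target_colour_def by (rule someI2_ex) simp
  qed
  moreover have "e \<subseteq> target_verts R d k \<and> card e = 2" if "e \<in> target_edges R d k" for e
    using that by (auto simp: target_edges_def card_insert_if)
  ultimately show ?thesis
    unfolding ec_graph_def target_def fin_graph_def by (auto simp: finite_target_verts)
qed

lemma target_colour_unique:
  assumes "c \<in> {1..k}" "link x y c" "\<And>c'. link x y c' \<Longrightarrow> c' = c"
  shows "target_colour k {x, y} = c"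
  unfolding target_colour_def
proof (rule some_equality)
  show "c \<in> {1..k} \<and> (\<exists>x' y'. {x, y} = {x', y'} \<and> link x' y' c)" using assms by blast
next
  fix c' assume "c' \<in> {1..k} \<and> (\<exists>x' y'. {x, y} = {x', y'} \<and> link x' y' c')"
  then have "link x y c'" by (auto simp: doubleton_eq_iff link_sym)
  then show "c' = c" by (rule assms(3))
qed

text \<open>
  An arc from \<open>u\<close> to \<open>v\<close> contributes its colour to the label of \<open>u\<close>. No other entry of the two labels refers to
  this pair of auxiliary colours: another entry at \<open>u\<close> would need a fork centred at \<open>u\<close>, and an entry at
  \<open>v\<close> would need a directed path through \<open>v\<close>, with ends of equal auxiliary colours. Unused places in the list at
  \<open>v\<close> are filled with the entry \<open>(\<psi> v, 1)\<close>, which is never consulted since adjacent vertices have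
  different auxiliary colours.
\<close>

lemma hom_to_target:
  fixes V :: "'a set" and \<psi> :: "'a \<Rightarrow> nat"
  assumes G: "ec_graph k ((V, E), c)" and k: "1 \<le> k"
    and tail: "\<And>e. e \<in> E \<Longrightarrow> t e \<in> e" and outdeg: "\<And>v. card {e \<in> E. t e = v} \<le> d"
    and \<psi>R: "\<And>v. v \<in> V \<Longrightarrow> \<psi> v < R"
    and proper: "\<And>u v. {u, v} \<in> E \<Longrightarrow> \<psi> u \<noteq> \<psi> v"
    and path: "\<And>u v w. {u, v} \<in> E \<Longrightarrow> t {u, v} = u \<Longrightarrow> {v, w} \<in> E \<Longrightarrow> t {v, w} = v \<Longrightarrow> \<psi> u \<noteq> \<psi> w"
    and fork: "\<And>u v w. {v, u} \<in> E \<Longrightarrow> t {v, u} = v \<Longrightarrow> {v, w} \<in> E \<Longrightarrow> t {v, w} = v \<Longrightarrow> u \<noteq> w \<Longrightarrow> \<psi> u \<noteq> \<psi> w"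
  shows "\<exists>h. ec_hom h ((V, E), c) (target R d k)"
proof -
  have fg: "finite V" "\<And>e. e \<in> E \<Longrightarrow> e \<subseteq> V" "\<And>e. e \<in> E \<Longrightarrow> card e = 2"
    and ck: "\<And>e. e \<in> E \<Longrightarrow> c e \<in> {1..k}"
    using G unfolding ec_graph_def fin_graph_def by auto
  have fE: "finite E" by (rule finite_subset[of _ "Pow V"]) (use fg in auto)
  define out where "out v = {w. {v, w} \<in> E \<and> t {v, w} = v}" for v
  define A where "A v = (\<lambda>w. (\<psi> w, c {v, w})) ` out v" for v
  have outE: "(\<lambda>w. {v, w}) ` out v \<subseteq> {e \<in> E. t e = v}" for v by (auto simp: out_def)
  have inj: "inj_on (\<lambda>w. {v, w}) (out v)" for v by (auto simp: inj_on_def doubleton_eq_iff)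
  have fout: "finite (out v)" for v
    by (rule finite_imageD[OF finite_subset[OF outE] inj]) (simp add: fE)
  have "card (out v) \<le> d" for v
    using card_mono[OF _ outE[of v]] card_image[OF inj[of v]] fE outdeg[of v] by force
  then have "card (A v) \<le> d" for v
    unfolding A_def using card_image_le[OF fout] le_trans by blast
  then have "\<exists>xs. length xs = d \<and> A v \<subseteq> set xs \<and> set xs \<subseteq> insert (\<psi> v, 1) (A v)" for v
    by (intro list_cover) (simp_all add: A_def fout)
  then obtain L where L: "\<And>v. length (L v) = d" "\<And>v. A v \<subseteq> set (L v)"
    "\<And>v. set (L v) \<subseteq> insert (\<psi> v, 1) (A v)" by metis
  define h where "h v = (\<psi> v, L v)" for v
  have hV: "h v \<in> target_verts R d k" if v: "v \<in> V" for v
  proof -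
    have "A v \<subseteq> {..<R} \<times> {1..k}"
      using ck \<psi>R fg(2) by (fastforce simp: A_def out_def)
    then have "set (L v) \<subseteq> {..<R} \<times> {1..k}" using L(3)[of v] \<psi>R[OF v] k by fastforce
    then show ?thesis using L(1) \<psi>R[OF v] by (simp add: h_def target_verts_def)
  qed
  have directed: "link (h u) (h v) (c {u, v}) \<and> (\<forall>c'. link (h u) (h v) c' \<longrightarrow> c' = c {u, v})"
    if uv: "{u, v} \<in> E" "t {u, v} = u" for u v
  proof (intro conjI allI impI)
    have "v \<in> out u" using uv by (simp add: out_def)
    then have "(\<psi> v, c {u, v}) \<in> set (L u)" using L(2)[of u] by (auto simp: A_def)
    then show "link (h u) (h v) (c {u, v})" by (simp add: link_def h_def)
    fix c' assume "link (h u) (h v) c'"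
    then consider "(\<psi> v, c') \<in> set (L u)" | "(\<psi> u, c') \<in> set (L v)" by (auto simp: link_def h_def)
    then show "c' = c {u, v}"
    proof cases
      case 1
      then have "(\<psi> v, c') \<in> A u" using L(3)[of u] proper[OF uv(1)] by auto
      then obtain w where "w \<in> out u" "\<psi> v = \<psi> w" "c' = c {u, w}" by (auto simp: A_def)
      then show ?thesis using fork[of u v w] uv by (auto simp: out_def)
    next
      case 2
      then have "(\<psi> u, c') \<in> A v" using L(3)[of v] proper[OF uv(1)] by auto
      then obtain w where "w \<in> out v" "\<psi> u = \<psi> w" by (auto simp: A_def)
      then show ?thesis using path[OF uv, of w] by (auto simp: out_def)
    qed
  qed
  have "ec_hom h ((V, E), c) (target R d k)"
    unfolding ec_hom_def target_def prod.case fst_conv snd_conv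
  proof (intro conjI allI impI)
    show "h ` V \<subseteq> target_verts R d k" using hV by auto
    fix u v assume uv: "{u, v} \<in> E"
    have lk: "link (h u) (h v) (c {u, v}) \<and> (\<forall>c'. link (h u) (h v) c' \<longrightarrow> c' = c {u, v})"
      using tail[OF uv] directed[of u v] directed[of v u] uv
      by (auto simp: insert_commute link_sym)
    have "h u \<in> target_verts R d k" "h v \<in> target_verts R d k" using hV fg(2)[OF uv] by auto
    moreover have "fst (h u) \<noteq> fst (h v)" using proper[OF uv] by (simp add: h_def)
    ultimately show "{h u, h v} \<in> target_edges R d k"
      unfolding target_edges_def using lk ck[OF uv] by blast
    show "c {u, v} = target_colour k {h u, h v}"
      using target_colour_unique[OF ck[OF uv]] lk by metis
  qed
  then show ?thesis by blast
qed

lemma lambda_univ_le: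
  fixes H :: "'b::countable ecgraph"
  assumes "universal F k H"
  shows "lambda_univ F k \<le> enat (card (verts (fst H)))"
proof -
  obtain W D b where H: "H = ((W, D), b)" by (metis surj_pair)
  have ec: "ec_graph k ((W, D), b)" using assms H by (simp add: universal_def)
  define H' :: "nat ecgraph" where
    "H' = ((to_nat ` W, (`) to_nat ` D), \<lambda>e. b (to_nat -` e))"
  have inj: "inj (to_nat :: 'b \<Rightarrow> nat)" by simp
  have "ec_graph k H'"
    using ec inj unfolding ec_graph_def H'_def fin_graph_def
    by (auto simp: card_image inj_on_subset[OF inj] inj_vimage_image_eq image_subset_iff) 
  moreover have "\<exists>h. ec_hom h (G, c) H'" if G: "G \<in> F" "ec_graph k (G, c)" for G c
  proof -
    obtain h where h: "ec_hom h (G, c) ((W, D), b)"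
      using assms G unfolding universal_def H by blast
    have "ec_hom (to_nat \<circ> h) (G, c) H'"
      unfolding ec_hom_def H'_def prod.case fst_conv snd_conv
    proof (intro conjI allI impI)
      show "(to_nat \<circ> h) ` verts G \<subseteq> to_nat ` W"
        using h by (auto simp: ec_hom_def)
      fix u v assume uv: "{u, v} \<in> edges G"
      have e: "{h u, h v} \<in> D" "c {u, v} = b {h u, h v}" using h uv by (auto simp: ec_hom_def)
      have im: "{(to_nat \<circ> h) u, (to_nat \<circ> h) v} = to_nat ` {h u, h v}" by simp
      show "{(to_nat \<circ> h) u, (to_nat \<circ> h) v} \<in> (`) to_nat ` D" unfolding im using e(1) by (rule imageI)
      show "c {u, v} = b (to_nat -` {(to_nat \<circ> h) u, (to_nat \<circ> h) v})"
        unfolding im inj_vimage_image_eq[OF inj] by (rule e(2))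
    qed
    then show ?thesis by blast
  qed
  ultimately have "universal F k H'" by (simp add: universal_def)
  then have "lambda_univ F k \<le> enat (card (verts (fst H')))"
    unfolding lambda_univ_def by (intro INF_lower) simp
  also have "card (verts (fst H')) = card W" by (simp add: H'_def card_image inj_on_subset[OF inj])
  finally show ?thesis by (simp add: H)
qed

text \<open>
  The palette has \<open>97 = 2 * 48 + 1\<close> colours, as \<open>48\<close> is the density of the conflicts.
\<close>

lemma universal_target: "1 \<le> k \<Longrightarrow> universal {G :: 'a::linorder graph. planar G} k (target 97 3 k)"
  unfolding universal_def
proof (intro conjI ballI allI impI ec_graph_target)
  fix G :: "'a graph" and c
  assume k: "1 \<le> k" and G: "G \<in> {G. planar G}" and ec: "ec_graph k (G, c)"
  obtain V E where VE: "G = (V, E)" by (metis surj_pair)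
  with G have "planar (V, E)" by simp
  then obtain p \<gamma> where pg: "plane_graph V E p \<gamma>" unfolding planar_iff_plane_graph by blast
  interpret plane_graph V E p \<gamma> by (rule pg)
  obtain t where t: "\<And>e. e \<in> E \<Longrightarrow> t e \<in> e" "\<And>v. card {e \<in> E. t e = v} \<le> 3"
    using orientation_outdegree_3 by metis
  define A where "A = arcs_of E t"
  define D where "D = A \<union> A O A \<union> forks A"
  have irrA: "u \<noteq> v" if "(u, v) \<in> A" for u v
    using that edge_card[of "{u, v}"] by (auto simp: A_def arcs_of_def)
  have asym: "(v, u) \<notin> A" if "(u, v) \<in> A" for u v
    using that irrA[OF that] by (auto simp: A_def arcs_of_def insert_commute)
  have "\<exists>\<psi> :: 'a \<Rightarrow> nat. (\<forall>v\<in>V. \<psi> v \<le> 2 * 48) \<and> (\<forall>u\<in>V. \<forall>w\<in>V. (u, w) \<in> D \<longrightarrow> \<psi> u \<noteq> \<psi> w)"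
  proof (rule sparse_colouring[OF finV])
    show "card (D \<inter> T \<times> T) \<le> 48 * card T" if "T \<subseteq> V" for T
      unfolding D_def A_def by (rule conflict_sparse[OF pg t(2) that])
    show "(v, v) \<notin> D" for v using irrA asym by (auto simp: D_def forks_def)
  qed
  then obtain \<psi> :: "'a \<Rightarrow> nat" where \<psi>: "\<And>v. v \<in> V \<Longrightarrow> \<psi> v \<le> 2 * 48"
    "\<And>u w. u \<in> V \<Longrightarrow> w \<in> V \<Longrightarrow> (u, w) \<in> D \<Longrightarrow> \<psi> u \<noteq> \<psi> w"
    by blast
  have \<psi>D: "\<psi> u \<noteq> \<psi> w" if "(u, w) \<in> D" for u w
  proof -
    have "A \<subseteq> V \<times> V" using edge_sub by (auto simp: A_def arcs_of_def)
    then have "D \<subseteq> V \<times> V" by (auto simp: D_def forks_def)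
    then show ?thesis using \<psi>(2) that by auto
  qed
  have inA: "{u, v} \<in> E \<Longrightarrow> t {u, v} = u \<Longrightarrow> (u, v) \<in> A" for u v by (simp add: A_def arcs_of_def)
  show "\<exists>h. ec_hom h (G, c) (target 97 3 k)"
    unfolding VE
  proof (rule hom_to_target[where \<psi> = \<psi> and t = t])
    show "ec_graph k ((V, E), c)" using ec VE by simp
    show "\<psi> v < 97" if "v \<in> V" for v using \<psi>(1)[OF that] by simp
    show "\<psi> u \<noteq> \<psi> v" if "{u, v} \<in> E" for u v
    proof -
      have "(u, v) \<in> A \<or> (v, u) \<in> A"
        using t(1)[OF that] inA[of u v] inA[of v u] that by (auto simp: insert_commute)
      then show ?thesis using \<psi>D[of u v] \<psi>D[of v u] by (auto simp: D_def)
    qed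
    show "\<psi> u \<noteq> \<psi> w" if "{u, v} \<in> E" "t {u, v} = u" "{v, w} \<in> E" "t {v, w} = v" for u v w
      using \<psi>D[of u w] inA that by (auto simp: D_def)
    show "\<psi> u \<noteq> \<psi> w" if "{v, u} \<in> E" "t {v, u} = v" "{v, w} \<in> E" "t {v, w} = v" "u \<noteq> w" for u v w
    proof -
      have "(u, w) \<in> forks A \<or> (w, u) \<in> forks A"
        using that inA[of v u] inA[of v w] unfolding forks_def by (cases "u < w") auto
      then show ?thesis using \<psi>D[of u w] \<psi>D[of w u] by (auto simp: D_def)
    qed
  qed (use t k in auto)
qed

section \<open>The lower bound: counting colourings of a dense planar graph\<close>

text \<open>
  Different colourings of \<open>G\<close> need different vertex maps, because the colour of an edge can be read off the
  image of its ends.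
\<close>

lemma universal_counting:
  assumes "universal F k H" "G \<in> F" "fin_graph G"
  shows "k ^ card (edges G) \<le> card (verts (fst H)) ^ card (verts G)"
proof -
  obtain V E where Geq: "G = (V, E)" by (metis surj_pair)
  obtain W D b where H: "H = ((W, D), b)" by (metis surj_pair)
  have fV: "finite V" and EV: "\<And>e. e \<in> E \<Longrightarrow> e \<subseteq> V" and E2: "\<And>e. e \<in> E \<Longrightarrow> card e = 2"
    using assms(3) by (auto simp: Geq fin_graph_def)
  have fE: "finite E" by (rule finite_subset[of _ "Pow V"]) (use fV EV in auto)
  have fW: "finite W" using assms(1) by (simp add: universal_def H ec_graph_def fin_graph_def)
  define cols where "cols = E \<rightarrow>\<^sub>E {1..k}"
  have "\<exists>h. ec_hom h (G, c) H" if "c \<in> cols" for c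
  proof -
    have "ec_graph k (G, c)" using that assms(3) by (auto simp: ec_graph_def cols_def Geq)
    then show ?thesis using assms(1,2) by (auto simp: universal_def)
  qed
  then obtain hom where hom: "\<And>c. c \<in> cols \<Longrightarrow> ec_hom (hom c) (G, c) H" by metis
  define \<Phi> where "\<Phi> c = restrict (hom c) V" for c
  have rec: "c e = b (\<Phi> c ` e)" if "c \<in> cols" "e \<in> E" for c e
  proof -
    obtain u v where e: "e = {u, v}" using E2[OF \<open>e \<in> E\<close>] by (meson card_2_iff)
    have "c {u, v} = b {hom c u, hom c v}"
      using hom[OF that(1)] that(2) e by (auto simp: ec_hom_def Geq H)
    moreover have "\<Phi> c u = hom c u" "\<Phi> c v = hom c v" using EV[OF that(2)] e by (auto simp: \<Phi>_def)
    ultimately show ?thesis using e by simp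
  qed
  have "inj_on \<Phi> cols"
  proof (rule inj_onI)
    fix c c' assume c: "c \<in> cols" "c' \<in> cols" "\<Phi> c = \<Phi> c'"
    show "c = c'"
    proof (rule PiE_ext[of c E "\<lambda>_. {1..k}" c'])
      show "c e = c' e" if "e \<in> E" for e
        using rec[OF c(1) that] rec[OF c(2) that] c(3) by simp
    qed (use c(1,2) in \<open>simp_all add: cols_def\<close>)
  qed
  moreover have "\<Phi> ` cols \<subseteq> V \<rightarrow>\<^sub>E W"
    using hom by (fastforce simp: \<Phi>_def ec_hom_def Geq H)
  ultimately have "card cols \<le> card (V \<rightarrow>\<^sub>E W)"
    using fV fW by (intro card_inj_on_le[of \<Phi>]) (auto intro: finite_PiE)
  then show ?thesis using fV fE by (simp add: cols_def card_PiE Geq H)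
qed

text \<open>
  If \<open>N < k ^ d\<close> then \<open>(1 + 1 / N) ^ n\<close> would stay below the constant \<open>k ^ c\<close>, contradicting Bernoulli's
  inequality for large \<open>n\<close>.
\<close>

lemma power_comparison:
  fixes N k c :: nat
  assumes "1 \<le> k" "\<And>n. a \<le> n \<Longrightarrow> k ^ (d * n) \<le> k ^ c * N ^ n"
  shows "k ^ d \<le> N"
proof (rule ccontr)
  assume "\<not> ?thesis"
  then have less: "N + 1 \<le> k ^ d" by simp
  define n where "n = N * k ^ c + a + 1"
  have "(N + 1) ^ n \<le> (k ^ d) ^ n" using less by (rule power_mono) simp
  also have "\<dots> = k ^ (d * n)" by (rule power_mult[symmetric])
  also have "\<dots> \<le> k ^ c * N ^ n" by (rule assms(2)) (simp add: n_def)
  finally have le: "(N + 1) ^ n \<le> k ^ c * N ^ n" .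
  show False
  proof (cases "N = 0")
    case True
    then show False using le by (simp add: n_def)
  next
    case False
    have "1 + real n * (1 / real N) \<le> (1 + 1 / real N) ^ n"
      by (rule Bernoulli_inequality) (use False in \<open>simp add: order_trans[of _ 0]\<close>)
    also have "(1 + 1 / real N) ^ n = real ((N + 1) ^ n) / real N ^ n"
      using False by (simp add: power_divide[symmetric] add_divide_distrib add.commute)
    also have "\<dots> \<le> real (k ^ c * N ^ n) / real N ^ n"
      using le by (intro divide_right_mono) (simp_all only: of_nat_le_iff, simp)
    also have "\<dots> = real (k ^ c)" using False by simp
    finally have "real n / real N < real (k ^ c)" by simp
    then have "real n < real (k ^ c) * real N" using False by (simp add: field_simps)
    then have "n < k ^ c * N" by (metis of_nat_less_iff of_nat_mult)
    then show False by (simp add: n_def mult.commute)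
  qed
qed

text \<open>
  The double fan: the apices \<open>0\<close> and \<open>1\<close> are placed at \<open>\<i>\<close> and \<open>- \<i>\<close>, the path \<open>2, \<dots>, n + 1\<close> runs along
  the real axis, and all edges are straight.
\<close>

definition fan_edges :: "nat \<Rightarrow> nat set set" where
  "fan_edges n = (\<lambda>m. {0, m}) ` {2..n + 1} \<union> (\<lambda>m. {1, m}) ` {2..n + 1} \<union> (\<lambda>m. {m, m + 1}) ` {2..n}"

definition fan_point :: "nat \<Rightarrow> complex" where
  "fan_point m = (if m = 0 then \<i> else if m = 1 then - \<i> else of_nat m)"

definition fan_curve :: "nat set \<Rightarrow> real \<Rightarrow> complex" where
  "fan_curve e = linepath (fan_point (Min e)) (fan_point (Max e))"

lemma card_fan_edges:
  assumes "1 \<le> n"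
  shows "card (fan_edges n) = 3 * n - 1"
proof -
  define A where "A = (\<lambda>m. {0, m}) ` {2..n + 1}"
  define B where "B = (\<lambda>m. {1, m}) ` {2..n + 1}"
  define D where "D = (\<lambda>m. {m, m + 1}) ` {2..n}"
  have "card A = card {2..n + 1}" "card B = card {2..n + 1}" "card D = card {2..n}"
    unfolding A_def B_def D_def
    by (rule card_image, force simp: inj_on_def doubleton_eq_iff)+
  then have "card A = n" "card B = n" "card D = n - 1" using assms by simp_all
  moreover have "0 \<in> e \<and> 1 \<notin> e" if "e \<in> A" for e using that by (auto simp: A_def)
  moreover have "0 \<notin> e \<and> 1 \<in> e" if "e \<in> B" for e using that by (auto simp: B_def)
  moreover have "0 \<notin> e \<and> 1 \<notin> e" if "e \<in> D" for e using that by (auto simp: D_def)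
  ultimately have "A \<inter> B = {}" "(A \<union> B) \<inter> D = {}" by blast+
  moreover have "finite A" "finite B" "finite D" by (simp_all add: A_def B_def D_def)
  moreover have "fan_edges n = A \<union> B \<union> D" by (simp only: fan_edges_def A_def B_def D_def)
  ultimately show ?thesis
    using \<open>card A = n\<close> \<open>card B = n\<close> \<open>card D = n - 1\<close> assms by (simp add: card_Un_disjoint)
qed

lemma fan_curve_cases:
  assumes "e \<in> fan_edges n"
  obtains (top) m where "2 \<le> m" "e = {0, m}" "fan_curve e = (\<lambda>s. Complex (s * real m) (1 - s))"
  | (bottom) m where "2 \<le> m" "e = {1, m}" "fan_curve e = (\<lambda>s. Complex (s * real m) (s - 1))"
  | (axis) m where "2 \<le> m" "e = {m, m + 1}" "fan_curve e = (\<lambda>s. Complex (real m + s) 0)"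
proof -
  consider m where "2 \<le> m" "e = {0, m}" | m where "2 \<le> m" "e = {1, m}" | m where "2 \<le> m" "e = {m, m + 1}"
    using assms by (auto simp: fan_edges_def)
  then show ?thesis
  proof cases
    case 1
    then have "fan_curve e = (\<lambda>s. Complex (s * real m) (1 - s))"
      by (intro ext) (simp add: fan_curve_def fan_point_def linepath_def complex_eq_iff)
    with 1 show ?thesis by (rule top)
  next
    case 2
    then have "fan_curve e = (\<lambda>s. Complex (s * real m) (s - 1))"
      by (intro ext) (simp add: fan_curve_def fan_point_def linepath_def complex_eq_iff)
    with 2 show ?thesis by (rule bottom)
  next
    case 3
    then have "fan_curve e = (\<lambda>s. Complex (real m + s) 0)"
      by (intro ext) (simp add: fan_curve_def fan_point_def linepath_def complex_eq_iff algebra_simps)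
    with 3 show ?thesis by (rule axis)
  qed
qed

text \<open>
  The sign of the imaginary part separates the upper fan, the lower fan and the path. Within a fan, the height
  of a point gives the parameter and then its real part identifies the spoke; on the axis, the
  unit intervals between integers are disjoint.
\<close>

lemma fan_curves_disjoint:
  assumes "e \<in> fan_edges n" "f \<in> fan_edges n" "0 < s" "s < 1" "0 \<le> t" "t \<le> 1"
    and eq: "fan_curve e s = fan_curve f t"
  shows "e = f"
  using assms(1)
proof (cases rule: fan_curve_cases)
  case e: (top m)
  from assms(2) show ?thesis
  proof (cases rule: fan_curve_cases)
    case (top m') then show ?thesis using e eq assms(3) by auto
  next
    case (bottom m') then show ?thesis using e eq assms(3-6) by simp
  next
    case (axis m') then show ?thesis using e eq assms(3-6) by simp
  qed
next
  case e: (bottom m)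
  from assms(2) show ?thesis
  proof (cases rule: fan_curve_cases)
    case (top m') then show ?thesis using e eq assms(3-6) by simp
  next
    case (bottom m') then show ?thesis using e eq assms(3) by auto
  next
    case (axis m') then show ?thesis using e eq assms(3-6) by simp
  qed
next
  case e: (axis m)
  from assms(2) show ?thesis
  proof (cases rule: fan_curve_cases)
    case (top m')
    then have "real m + s = real m'" using e eq by simp
    then have "real m < real m'" "real m' < real (m + 1)" using assms(3,4) by auto
    then show ?thesis by simp
  next
    case (bottom m')
    then have "real m + s = real m'" using e eq by simp
    then have "real m < real m'" "real m' < real (m + 1)" using assms(3,4) by auto
    then show ?thesis by simp
  next
    case (axis m')
    then have "real m + s = real m' + t" using e eq by simp
    then have "real m < real (m' + 1)" "real m' < real (m + 1)" using assms(3-6) by auto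
    then have "m = m'" by simp
    then show ?thesis using e axis by simp
  qed
qed

lemma planar_fan: "planar ({..n + 1}, fan_edges n)"
proof -
  have card2: "e \<subseteq> {..n + 1} \<and> card e = 2" if "e \<in> fan_edges n" for e
    using that by (auto simp: fan_edges_def)
  have inj: "inj fan_point"
  proof (rule injI)
    fix x y assume "fan_point x = fan_point y"
    then show "x = y" by (auto simp: fan_point_def complex_eq_iff split: if_splits)
  qed
  have "plane_drawing ({..n + 1}, fan_edges n) fan_point fan_curve"
    unfolding plane_drawing_def fst_conv snd_conv
  proof (intro conjI ballI impI)
    show "inj_on fan_point {..n + 1}" using inj inj_on_subset by blast
    fix e assume e: "e \<in> fan_edges n"
    have mm: "e = {Min e, Max e}" "Min e \<noteq> Max e"
      using e by (auto simp: fan_edges_def)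
    then show "arc (fan_curve e)"
      using inj unfolding fan_curve_def by (intro arc_linepath) (auto dest: injD)
    show "{pathstart (fan_curve e), pathfinish (fan_curve e)} = fan_point ` e"
      by (subst (3) mm(1)) (simp add: fan_curve_def)
    show "fan_curve e ` {0<..<1} \<inter> fan_point ` {..n + 1} = {}"
    proof (rule ccontr)
      assume "\<not> ?thesis"
      then obtain s v where s: "0 < s" "s < 1" "fan_curve e s = fan_point v" by auto
      from e show False
      proof (cases rule: fan_curve_cases)
        case (top m) then show False using s by (auto simp: fan_point_def complex_eq_iff split: if_splits)
      next
        case (bottom m) then show False using s by (auto simp: fan_point_def complex_eq_iff split: if_splits)
      next
        case (axis m)
        then have "real m + s = real v"
          using s by (auto simp: fan_point_def complex_eq_iff split: if_splits)
        then have "real m < real v" "real v < real (m + 1)" using s by auto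
        then show False by simp
      qed
    qed
    fix f assume f: "f \<in> fan_edges n" "f \<noteq> e"
    show "fan_curve e ` {0<..<1} \<inter> path_image (fan_curve f) = {}"
      using fan_curves_disjoint[OF e f(1)] f(2) by (auto simp: path_image_def)
  qed
  then show ?thesis using card2 unfolding planar_def fin_graph_def by auto
qed

text \<open>
  The constant \<open>7\<close> is the defect of the double fan, which has \<open>3 n - 7\<close> edges on \<open>n\<close> vertices.
\<close>

lemma universal_planar_lower_bound:
  assumes "1 \<le> k" "universal {G :: nat graph. planar G} k H"
  shows "k ^ 3 \<le> card (verts (fst H))"
proof (rule power_comparison[OF assms(1)])
  fix n :: nat assume n: "3 \<le> n"
  define m where "m = n - 2"
  have m: "1 \<le> m" "n = m + 2" using n by (auto simp: m_def)
  have pl: "planar ({..m + 1}, fan_edges m)" by (rule planar_fan)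
  then have "k ^ card (fan_edges m) \<le> card (verts (fst H)) ^ card {..m + 1}"
    using universal_counting[OF assms(2), of "({..m + 1}, fan_edges m)"] by (simp add: planar_def)
  then have "k ^ (3 * m - 1) \<le> card (verts (fst H)) ^ n"
    using m by (simp add: card_fan_edges)
  moreover have "3 * n = 7 + (3 * m - 1)" using m by simp
  ultimately show "k ^ (3 * n) \<le> k ^ 7 * card (verts (fst H)) ^ n" by (simp only: power_add mult_le_mono2)
qed

lemma lambda_univ_planar_bounds:
  assumes "1 \<le> k"
  obtains m where "lambda_univ {G. planar G} k = enat m" "k ^ 3 \<le> m" "m \<le> 97 ^ 4 * k ^ 3"
proof -
  have up: "lambda_univ {G. planar G} k \<le> enat (97 ^ 4 * k ^ 3)"
    using lambda_univ_le[OF universal_target[OF assms]]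
    by (simp add: target_def card_target_verts power_mult_distrib)
  moreover have "enat (k ^ 3) \<le> lambda_univ {G. planar G} k"
    unfolding lambda_univ_def
    using universal_planar_lower_bound[OF assms] by (intro INF_greatest) (simp add: numeral_eq_enat)
  ultimately show ?thesis using that by (cases "lambda_univ {G. planar G} k") auto
qed

theorem corollary8:
  "(\<forall>\<^sub>F k in at_top. lambda_univ {G. planar G} k \<noteq> \<infinity>) \<and>
   (\<lambda>k. real (the_enat (lambda_univ {G. planar G} k))) \<in> \<Theta>(\<lambda>k. real k ^ 3)"
proof
  have bounds: "lambda_univ {G. planar G} k \<noteq> \<infinity> \<and>
      real k ^ 3 \<le> real (the_enat (lambda_univ {G. planar G} k)) \<and>
      real (the_enat (lambda_univ {G. planar G} k)) \<le> 97 ^ 4 * real k ^ 3" if k: "1 \<le> k" for k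
  proof -
    obtain m where m: "lambda_univ {G. planar G} k = enat m" "k ^ 3 \<le> m" "m \<le> 97 ^ 4 * k ^ 3"
      using lambda_univ_planar_bounds[OF k] .
    have "real (k ^ 3) \<le> real m" "real m \<le> real (97 ^ 4 * k ^ 3)"
      using m(2,3) by (simp_all only: of_nat_le_iff)
    then show ?thesis using m(1) by simp
  qed
  show "\<forall>\<^sub>F k in at_top. lambda_univ {G. planar G} k \<noteq> \<infinity>"
    using eventually_ge_at_top[of 1] by eventually_elim (use bounds in blast)
  show "(\<lambda>k. real (the_enat (lambda_univ {G. planar G} k))) \<in> \<Theta>(\<lambda>k. real k ^ 3)"
  proof (rule bigthetaI)
    show "(\<lambda>k. real (the_enat (lambda_univ {G. planar G} k))) \<in> O(\<lambda>k. real k ^ 3)"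
      by (rule bigoI[of _ "97 ^ 4"], use eventually_ge_at_top[of 1] in eventually_elim)
        (use bounds in auto)
    show "(\<lambda>k. real (the_enat (lambda_univ {G. planar G} k))) \<in> \<Omega>(\<lambda>k. real k ^ 3)"
      by (rule landau_omega.bigI[of 1], simp, use eventually_ge_at_top[of 1] in eventually_elim)
        (use bounds in auto)
  qed
qed

end
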